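(* Let $1\le k\le n$ with $k\le 5$ or $k\ge n-5$. Let $I,J\in\binom{[n]}{k}$, $I\neq J$, be such that the lattice path $P(I,J)$ is a Dyck path. Then there exists an arrangement of smallest minors $S\subset\binom{[n]}{k}$ in $Gr^+(k,n)$ such that $I,J\in S$ if and only if one of the following holds: (1) the pair $I,J$ is $1$-interlaced (equivalently, it is weakly separated), or (2) the pair $I,J$ is $2$-interlaced and its length parameters $(\alpha_1,\beta_1,\alpha_2,\beta_2)$ satisfy $\alpha_i\neq\beta_j$ for any $i,j\in\{1,2\}$.
   Context: $[n]=\{1,\dots,n\}$ and $\binom{[n]}{k}$ is the set of $k$-element subsets of $[n]$. The Grassmannian $Gr(k,n)$ over $\mathbb{R}$ is the space of $k$-dimensional linear subspaces of $\mathbb{R}^n$, identified with real $k\times n$ matrices of rank $k$ modulo row operations. For $I\in\binom{[n]}{k}$, the Plücker coordinate $\Delta_I$ is the $k\times k$ minor in the column set $I$; the $\Delta_I$ are projective coordinates (defined up to a common nonzero factor). The positive Grassmannian $Gr^+(k,n)$ is the set of points of $Gr(k,n)$ all of whose Plücker coordinates have the same nonzero sign; we always choose a representative with $\Delta_I>0$ for all $I$. A subset $\mathcal{J}\subset\binom{[n]}{k}$ is an arrangement of smallest minors in $Gr^+(k,n)$ if it is nonempty and there is a point of $Gr^+(k,n)$ at which all $\Delta_I$, $I\in\mathcal{J}$, are equal to each other and $\Delta_K>\Delta_I$ for all $I\in\mathcal{J}$ and $K\in\binom{[n]}{k}\setminus\mathcal{J}$. Lattice path: let $r=|I\setminus J|=|J\setminus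 I|$ and $(I\setminus J)\cup(J\setminus I)=\{c_1<c_2<\dots<c_{2r}\}$. Then $P(I,J)$ is the lattice path in $\mathbb{Z}^2$ from $(0,0)$ to $(2r,0)$ whose $i$-th step is an up step $(1,1)$ if $c_i\in I\setminus J$ and a down step $(1,-1)$ if $c_i\in J\setminus I$. It is a Dyck path if it never goes below $y=0$. (For any pair, a cyclic shift of the indices makes it a Dyck path.) A pick (peak) of $P(I,J)$ is an index $i\in[2r-1]$ such that the $i$-th step is an up step and the $(i+1)$-st step is a down step. When $P(I,J)$ is a Dyck path, the pair $I,J$ is $p$-interlaced if the number of picks of $P(I,J)$ is $p$. For a $p$-interlaced pair, the length parameters $(\alpha_1,\beta_1,\dots,\alpha_p,\beta_p)$ are the lengths (numbers of steps), in order along the path, of the $2p$ maximal straight segments of $P(I,J)$: the $\alpha_i$ are the lengths of the maximal runs of up steps and the $\beta_j$ the lengths of the maximal runs of down steps. Two sets $I,J\in\binom{[n]}{k}$ are weakly separated if, writing $I\setminus J=\{a_1<\dots<a_r\}$ and $J\setminus I=\{b_1<\dots<b_r\}$, there is $s\in\{0,\dots,r\}$ with $a_1<\dots<a_s<b_1<\dots<b_r<a_{s+1}<\dots<a_r$, or the same holds with the $a$'s and $b$'s switched. *)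

theory Defs
  imports
    "Jordan_Normal_Form.DL_Rank"
    "Jordan_Normal_Form.DL_Submatrix"
    "HOL-Library.Product_Plus"
    "HOL-Library.Ramsey"
begin

section \<open>The positive Grassmannian\<close>

definition full_rank_mats :: "nat \<Rightarrow> nat \<Rightarrow> real mat set" where
  "full_rank_mats k n = {A \<in> carrier_mat k n. vec_space.rank k A = k}"

definition row_equiv :: "nat \<Rightarrow> nat \<Rightarrow> (real mat \<times> real mat) set" where
  "row_equiv k n = {(A, B). A \<in> full_rank_mats k n \<and> B \<in> full_rank_mats k n \<and>
     (\<exists>P \<in> carrier_mat k k. invertible_mat P \<and> B = P * A)}"

text \<open>A point of the Grassmannian is the set of all matrices whose rows form a basis of a given
  \<open>k\<close>-dimensional subspace of \<open>\<real>\<^sup>n\<close>.\<close>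

definition Grassmannian :: "nat \<Rightarrow> nat \<Rightarrow> real mat set set" where
  "Grassmannian k n = full_rank_mats k n // row_equiv k n"

text \<open>Column sets are subsets of \<open>{1..n}\<close>, whereas matrix columns are numbered from \<open>0\<close>;
  hence the shift.\<close>

definition pluecker :: "real mat \<Rightarrow> nat set \<Rightarrow> real" where
  "pluecker A I = det (submatrix A UNIV ((\<lambda>i. i - 1) ` I))"

definition pos_Grassmannian :: "nat \<Rightarrow> nat \<Rightarrow> real mat set set" where
  "pos_Grassmannian k n = {V \<in> Grassmannian k n. \<forall>A \<in> V.
     (\<forall>I \<in> nsets {1..n} k. pluecker A I > 0) \<or> (\<forall>I \<in> nsets {1..n} k. pluecker A I < 0)}"

definition arrangement_of_smallest_minors :: "nat \<Rightarrow> nat \<Rightarrow> nat set set \<Rightarrow> bool" where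
  "arrangement_of_smallest_minors k n \<J> \<longleftrightarrow>
     \<J> \<subseteq> nsets {1..n} k \<and> \<J> \<noteq> {} \<and>
     (\<exists>V \<in> pos_Grassmannian k n. \<exists>A \<in> V.
        (\<forall>I \<in> nsets {1..n} k. pluecker A I > 0) \<and>
        (\<forall>I \<in> \<J>. \<forall>I' \<in> \<J>. pluecker A I = pluecker A I') \<and>
        (\<forall>I \<in> \<J>. \<forall>K \<in> nsets {1..n} k - \<J>. pluecker A K > pluecker A I))"


section \<open>The lattice path of a pair of sets\<close>

text \<open>A lattice path starting at \<open>(0, 0)\<close> is given by its list of steps.\<close>

definition up_step :: "int \<times> int" where "up_step = (1, 1)"
definition down_step :: "int \<times> int" where "down_step = (1, -1)"

definition lattice_path :: "nat set \<Rightarrow> nat set \<Rightarrow> (int \<times> int) list" where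
  "lattice_path I J =
     map (\<lambda>c. if c \<in> I - J then up_step else down_step)
         (sorted_list_of_set ((I - J) \<union> (J - I)))"

definition path_vertex :: "(int \<times> int) list \<Rightarrow> nat \<Rightarrow> int \<times> int" where
  "path_vertex P i = sum_list (take i P)"

definition dyck_path :: "(int \<times> int) list \<Rightarrow> bool" where
  "dyck_path P \<longleftrightarrow> (\<forall>i \<le> length P. snd (path_vertex P i) \<ge> 0)"

text \<open>The \<open>i\<close>-th step, counted from \<open>1\<close>, is \<open>P ! (i - 1)\<close>.\<close>

definition picks :: "(int \<times> int) list \<Rightarrow> nat set" where
  "picks P = {i. 1 \<le> i \<and> i < length P \<and> P ! (i - 1) = up_step \<and> P ! i = down_step}"

definition interlaced :: "nat \<Rightarrow> nat set \<Rightarrow> nat set \<Rightarrow> bool" where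
  "interlaced p I J \<longleftrightarrow> dyck_path (lattice_path I J) \<and> card (picks (lattice_path I J)) = p"

text \<open>The lengths of the maximal blocks of equal consecutive entries of a list.\<close>

function run_lengths :: "'a list \<Rightarrow> nat list" where
  "run_lengths [] = []"
| "run_lengths (x # xs) =
     Suc (length (takeWhile (\<lambda>y. y = x) xs)) # run_lengths (dropWhile (\<lambda>y. y = x) xs)"
  by pat_completeness auto
termination
  by (relation "measure length") (auto simp: less_Suc_eq_le length_dropWhile_le)

text \<open>For a \<open>p\<close>-interlaced pair this is the list \<open>[\<alpha>\<^sub>1, \<beta>\<^sub>1, \<dots>, \<alpha>\<^sub>p, \<beta>\<^sub>p]\<close>: a Dyck path starts with
  an up step and ends with a down step.\<close>

definition length_parameters :: "nat set \<Rightarrow> nat set \<Rightarrow> nat list" where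
  "length_parameters I J = run_lengths (lattice_path I J)"


section \<open>Weak separation\<close>

definition weakly_separated :: "nat set \<Rightarrow> nat set \<Rightarrow> bool" where
  "weakly_separated I J \<longleftrightarrow>
     (let as = sorted_list_of_set (I - J); bs = sorted_list_of_set (J - I) in
        (\<exists>s \<le> length as. sorted_wrt (<) (take s as @ bs @ drop s as)) \<or>
        (\<exists>s \<le> length bs. sorted_wrt (<) (take s bs @ as @ drop s bs)))"

end

theory Submission
  imports Defs "Jordan_Normal_Form.DL_Rank_Submatrix"
begin

text \<open>
  Put \<open>r = card (I - J)\<close>. Since \<open>r \<le> k\<close> and \<open>r \<le> n - k\<close>, the hypothesis on \<open>k\<close> forces \<open>r \<le> 5\<close>,
  so the path of \<open>I, J\<close> is one of finitely many Dyck words. The sets \<open>I, J\<close> lie in a common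
  arrangement iff some totally positive configuration of columns has \<open>\<Delta>\<^sub>I = \<Delta>\<^sub>J\<close> minimal among all
  maximal minors (\<open>arrangement_iff_jointly_smallest\<close>), and the word alone decides whether this
  happens.

  \<^emph>\<open>Impossible words.\<close> At a positive point the three-term Pluecker relation says that
  \<open>\<Delta>\<^bsub>Sab\<^esub> \<Delta>\<^bsub>Scd\<^esub> < \<Delta>\<^bsub>Sac\<^esub> \<Delta>\<^bsub>Sbd\<^esub>\<close> whenever the pairs \<open>{a, c}\<close> and \<open>{b, d}\<close> cross. Suppose the
  elements of \<open>I - J\<close> are matched with those of \<open>J - I\<close>, and the matched pairs are split into two
  nonempty groups \<open>x\<^sub>i \<mapsto> y\<^sub>i\<close> and \<open>u\<^sub>j \<mapsto> v\<^sub>j\<close> such that \<open>{x\<^sub>i, u\<^sub>j}\<close> always crosses \<open>{y\<^sub>i, v\<^sub>j}\<close>. Exchanging the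
  pairs one at a time and multiplying the elementary inequalities over the resulting grid gives
  \<open>\<Delta>\<^bsub>X V\<^esub> \<Delta>\<^bsub>Y U\<^esub> < \<Delta>\<^sub>I \<Delta>\<^sub>J\<close> (\<open>exchange_pairs_inequality\<close>), so \<open>\<Delta>\<^sub>I\<close> and \<open>\<Delta>\<^sub>J\<close> are not both minimal. Such a
  matching exists when the path, read cyclically, attains its minimal or its maximal height twice:
  two such points cut it into two arcs that stay on one side of that height, and on each arc the
  \<open>i\<close>-th up step is matched with the \<open>i\<close>-th down step. With two peaks, twice at minimal height means
  \<open>\<alpha>\<^sub>1 = \<beta>\<^sub>1\<close> (and \<open>\<alpha>\<^sub>2 = \<beta>\<^sub>2\<close>), twice at maximal height means \<open>\<alpha>\<^sub>2 = \<beta>\<^sub>1\<close> (and \<open>\<alpha>\<^sub>1 = \<beta>\<^sub>2\<close>). With at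
  least three peaks and \<open>r \<le> 5\<close> only three words attain both extremal heights once; \<open>UUDUUDDUDD\<close>
  has a suitable matching all the same, and the mirror images \<open>UUDUDUUDDD\<close> and \<open>UUUDDUDUDD\<close> are
  excluded by an inequality between products of four minors (\<open>exceptional_exchange\<close>).

  \<^emph>\<open>Possible words.\<close> For each of the remaining words an explicit integer \<open>r \<times> 2r\<close> matrix settles the
  case where \<open>I\<close> and \<open>J\<close> are complementary. An element outside \<open>I \<union> J\<close> is then added as a new
  column, and an element of \<open>I \<inter> J\<close> as a new row and column, in such a way that old minors keep
  their values and all new minors are as large as desired (\<open>jointly_smallest_insert_outside\<close>,
  \<open>jointly_smallest_insert_common\<close>).
\<close>

section \<open>Minors and the three-term Pluecker relation\<close>

text \<open>Matrices are families \<open>a i x\<close> with rows \<open>i = 0, 1, \<dots>\<close> and arbitrary natural numbers \<open>x\<close> as column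
  labels. A minor uses as many initial rows as it has columns, so that columns can be relabelled,
  inserted and removed without renumbering.\<close>

definition minor :: "(nat \<Rightarrow> nat \<Rightarrow> real) \<Rightarrow> nat list \<Rightarrow> real" where
  "minor a xs = det (mat (length xs) (length xs) (\<lambda>(i, j). a i (xs ! j)))"

definition Delta :: "(nat \<Rightarrow> nat \<Rightarrow> real) \<Rightarrow> nat set \<Rightarrow> real" where
  "Delta a K = minor a (sorted_list_of_set K)"

definition skip_row :: "nat \<Rightarrow> (nat \<Rightarrow> nat \<Rightarrow> real) \<Rightarrow> nat \<Rightarrow> nat \<Rightarrow> real" where
  "skip_row r a i = a (if i < r then i else Suc i)"

lemma minor_cong:
  assumes "\<And>i x. i < length xs \<Longrightarrow> x \<in> set xs \<Longrightarrow> a i x = b i x"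
  shows "minor a xs = minor b xs"
  unfolding minor_def by (rule arg_cong[of _ _ det], rule eq_matI) (auto simp: assms)

lemma Delta_cong:
  assumes "finite K" "\<And>i x. i < card K \<Longrightarrow> x \<in> K \<Longrightarrow> a i x = b i x"
  shows "Delta a K = Delta b K"
  unfolding Delta_def using assms by (intro minor_cong) auto

lemma Delta_empty [simp]: "Delta a {} = 1"
  by (simp add: Delta_def minor_def)

lemma minor_map: "minor a (map c xs) = minor (\<lambda>i j. a i (c j)) xs"
  unfolding minor_def by (rule arg_cong[of _ _ det], rule eq_matI) auto

lemma minor_expand_column:
  "minor a (us @ c # vs) = (\<Sum>i<Suc (length (us @ vs)).
     (- 1) ^ (i + length us) * a i c * minor (skip_row i a) (us @ vs))"
proof -
  define m where "m = Suc (length (us @ vs))"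
  let ?M = "mat m m (\<lambda>(i, j). a i ((us @ c # vs) ! j))"
  have "minor a (us @ c # vs) = det ?M" by (simp add: minor_def m_def)
  also have "\<dots> = (\<Sum>i<m. ?M $$ (i, length us) * cofactor ?M i (length us))"
    by (rule laplace_expansion_column) (auto simp: m_def)
  also have "\<dots> = (\<Sum>i<m. (- 1) ^ (i + length us) * a i c * minor (skip_row i a) (us @ vs))"
  proof (rule sum.cong[OF refl])
    fix i assume i: "i \<in> {..<m}"
    have "mat_delete ?M i (length us) =
      mat (length (us @ vs)) (length (us @ vs)) (\<lambda>(i', j). skip_row i a i' ((us @ vs) ! j))"
      using i by (intro eq_matI)
        (auto simp: mat_delete_def skip_row_def m_def nth_append nth_Cons Suc_diff_le)
    then have "cofactor ?M i (length us) = (- 1) ^ (i + length us) * minor (skip_row i a) (us @ vs)"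
      by (simp add: cofactor_def minor_def)
    then show "?M $$ (i, length us) * cofactor ?M i (length us) =
        (- 1) ^ (i + length us) * a i c * minor (skip_row i a) (us @ vs)"
      using i by (auto simp: m_def)
  qed
  finally show ?thesis by (simp add: m_def)
qed

lemma minor_expand_row:
  assumes "r < length xs"
  shows "minor a xs = (\<Sum>j<length xs.
     (- 1) ^ (r + j) * a r (xs ! j) * minor (skip_row r a) (take j xs @ drop (Suc j) xs))"
proof -
  let ?m = "length xs"
  let ?M = "mat ?m ?m (\<lambda>(i, j). a i (xs ! j))"
  have "minor a xs = det ?M" by (simp add: minor_def)
  also have "\<dots> = (\<Sum>j<?m. ?M $$ (r, j) * cofactor ?M r j)"
    by (rule laplace_expansion_row) (use assms in auto)
  also have "\<dots> = (\<Sum>j<?m. (- 1) ^ (r + j) * a r (xs ! j)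
      * minor (skip_row r a) (take j xs @ drop (Suc j) xs))"
  proof (rule sum.cong[OF refl])
    fix j assume j: "j \<in> {..<?m}"
    have "mat_delete ?M r j = mat (length (take j xs @ drop (Suc j) xs))
       (length (take j xs @ drop (Suc j) xs))
       (\<lambda>(i, j'). skip_row r a i ((take j xs @ drop (Suc j) xs) ! j'))"
      using j by (intro eq_matI)
        (auto simp: mat_delete_def skip_row_def nth_append min_def)
    then have "cofactor ?M r j
        = (- 1) ^ (r + j) * minor (skip_row r a) (take j xs @ drop (Suc j) xs)"
      by (simp add: cofactor_def minor_def)
    then show "?M $$ (r, j) * cofactor ?M r j = (- 1) ^ (r + j) * a r (xs ! j)
        * minor (skip_row r a) (take j xs @ drop (Suc j) xs)"
      using assms j by auto
  qed
  finally show ?thesis .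
qed

lemma minor_repeated_row:
  assumes "r < length xs" "r' < length xs" "r \<noteq> r'" "a r = a r'"
  shows "minor a xs = 0"
  unfolding minor_def
  by (rule det_identical_rows[of _ "length xs" r r']) (use assms in \<open>auto simp: Matrix.row_def\<close>)

lemma minor_repeated_column:
  assumes "\<not> distinct xs"
  shows "minor a xs = 0"
proof -
  from assms obtain i j where ij: "i < length xs" "j < length xs" "i \<noteq> j" "xs ! i = xs ! j"
    by (auto simp: distinct_conv_nth)
  show ?thesis unfolding minor_def
    by (rule det_identical_cols[of _ "length xs" i j]) (use ij in \<open>auto simp: Matrix.col_def\<close>)
qed

lemma sorted_list_split:
  fixes L :: "nat set"
  assumes "finite L"
  obtains us vs where "sorted_list_of_set (insert c L) = us @ c # vs"
    "sorted_list_of_set (L - {c}) = us @ vs" "length us = card {x \<in> L. x < c}"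
proof -
  let ?xs = "sorted_list_of_set (insert c L)"
  have "c \<in> set ?xs" using assms by (metis finite_insert insertI1 set_sorted_list_of_set)
  then obtain us vs where s: "?xs = us @ c # vs" by (meson split_list)
  have d: "strict_sorted (us @ c # vs)" using s strict_sorted_list_of_set[of "insert c L"] by metis
  have st: "set (us @ c # vs) = insert c L" using s assms by (metis finite_insert set_sorted_list_of_set)
  have ss: "strict_sorted (us @ vs)" using d by (auto simp: sorted_wrt_append)
  have "c \<notin> set (us @ vs)" using d by (auto simp: sorted_wrt_append)
  then have st': "set us \<union> set vs = L - {c}" using st by auto
  then have 2: "sorted_list_of_set (L - {c}) = us @ vs"
    using ss by (metis set_append sorted_list_of_set.idem_if_sorted_distinct strict_sorted_iff)
  have "\<forall>x\<in>set us. x < c" "\<forall>x\<in>set vs. c < x" using d by (auto simp: sorted_wrt_append)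
  then have "set us = {x \<in> L. x < c}" using st' by (auto dest: less_asym)
  then have 3: "length us = card {x \<in> L. x < c}"
    using ss by (metis distinct_append distinct_card strict_sorted_iff)
  show ?thesis using that[OF s 2 3] .
qed

text \<open>The sum is linear in the column \<open>c\<close> of \<open>a\<close>. It vanishes when \<open>c \<in> L\<close>, since it is then the
  determinant of a matrix with two equal columns (next lemma).\<close>

lemma Delta_expand_column:
  assumes "finite L" "c \<notin> L"
  shows "Delta a (insert c L) = (- 1) ^ card {x \<in> L. x < c} *
    (\<Sum>i<Suc (card L). (- 1) ^ i * a i c * Delta (skip_row i a) L)"
proof -
  obtain us vs where s: "sorted_list_of_set (insert c L) = us @ c # vs"
    "sorted_list_of_set (L - {c}) = us @ vs" "length us = card {x \<in> L. x < c}"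
    using sorted_list_split[OF assms(1)] by blast
  have L: "sorted_list_of_set L = us @ vs" using s(2) assms by simp
  then have "length (us @ vs) = card L" by (metis length_sorted_list_of_set)
  then show ?thesis unfolding Delta_def s(1) minor_expand_column L s(3)
    by (simp add: sum_distrib_left power_add mult_ac del: sum.lessThan_Suc)
qed

lemma Delta_expand_column_repeated:
  assumes "finite L" "c \<in> L"
  shows "(\<Sum>i<Suc (card L). (- 1) ^ i * a i c * Delta (skip_row i a) L) = 0"
proof -
  have "minor a ([] @ c # sorted_list_of_set L) = 0"
    by (rule minor_repeated_column) (use assms in simp)
  then show ?thesis unfolding minor_expand_column Delta_def by simp
qed

lemma Delta_expand_row:
  assumes "finite Y" "r < card Y"
  shows "Delta a Y = (\<Sum>y\<in>Y. (- 1) ^ (r + card {x \<in> Y. x < y}) * a r y * Delta (skip_row r a) (Y - {y}))"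
proof -
  let ?xs = "sorted_list_of_set Y"
  let ?g = "\<lambda>y. (- 1) ^ (r + card {x \<in> Y. x < y}) * a r y * Delta (skip_row r a) (Y - {y})"
  have "Delta a Y = (\<Sum>j<length ?xs. (- 1) ^ (r + j) * a r (?xs ! j)
      * minor (skip_row r a) (take j ?xs @ drop (Suc j) ?xs))"
    unfolding Delta_def by (rule minor_expand_row) (use assms in simp)
  also have "\<dots> = (\<Sum>j<length ?xs. ?g (?xs ! j))"
  proof (rule sum.cong[OF refl])
    fix j assume j: "j \<in> {..<length ?xs}"
    have d: "strict_sorted ?xs" by (rule strict_sorted_list_of_set)
    have y: "?xs ! j \<in> Y" using j assms by (metis lessThan_iff nth_mem set_sorted_list_of_set)
    have id: "?xs = take j ?xs @ ?xs ! j # drop (Suc j) ?xs" using j by (simp add: id_take_nth_drop)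
    obtain us vs where s: "sorted_list_of_set (insert (?xs ! j) Y) = us @ ?xs ! j # vs"
      "sorted_list_of_set (Y - {?xs ! j}) = us @ vs" "length us = card {x \<in> Y. x < ?xs ! j}"
      using sorted_list_split[OF assms(1)] by blast
    have e: "take j ?xs @ ?xs ! j # drop (Suc j) ?xs = us @ ?xs ! j # vs"
      using s(1) y id by (simp add: insert_absorb)
    have "distinct (us @ ?xs ! j # vs)" using e id d by (metis strict_sorted_iff)
    moreover have "distinct (take j ?xs @ ?xs ! j # drop (Suc j) ?xs)"
      using id d by (metis strict_sorted_iff)
    ultimately have "us = take j ?xs \<and> vs = drop (Suc j) ?xs"
      using e by (metis append_Cons_eq_iff distinct_append not_distinct_conv_prefix list.set_intros(1) disjoint_iff distinct.simps(2))
    then show "(- 1) ^ (r + j) * a r (?xs ! j) * minor (skip_row r a) (take j ?xs @ drop (Suc j) ?xs)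
        = ?g (?xs ! j)"
      using s j by (simp add: Delta_def)
  qed
  also have "\<dots> = (\<Sum>y\<in>Y. ?g y)"
    by (rule sum.reindex_bij_betw[of "\<lambda>j. ?xs ! j"]) (use assms in \<open>auto intro!: bij_betw_nth\<close>)
  finally show ?thesis .
qed

lemma Delta_expand_last_row:
  assumes "finite Y" "card Y = Suc n"
  shows "Delta a Y = (\<Sum>y\<in>Y. (- 1) ^ (n + card {x \<in> Y. x < y}) * a n y * Delta a (Y - {y}))"
proof -
  have "Delta (skip_row n a) (Y - {y}) = Delta a (Y - {y})" if "y \<in> Y" for y
    using that assms by (intro Delta_cong) (auto simp: skip_row_def)
  then show ?thesis using Delta_expand_row[of Y n a] assms by simp
qed

text \<open>The sum is the expansion along the last row of a determinant whose last row repeats row \<open>r\<close>.\<close>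

lemma Delta_expand_alien_row:
  assumes "finite Y" "card Y = Suc n" "r < n"
  shows "(\<Sum>y\<in>Y. (- 1) ^ card {x \<in> Y. x < y} * a r y * Delta a (Y - {y})) = 0"
proof -
  let ?b = "a(n := a r)"
  have "Delta ?b Y = 0" unfolding Delta_def
    by (rule minor_repeated_row[of r _ n]) (use assms in auto)
  moreover have "Delta ?b (Y - {y}) = Delta a (Y - {y})" if "y \<in> Y" for y
    using that assms by (intro Delta_cong) auto
  ultimately have "(\<Sum>y\<in>Y. (- 1) ^ (n + card {x \<in> Y. x < y}) * a r y * Delta a (Y - {y})) = 0"
    using Delta_expand_last_row[OF assms(1,2), of ?b] by simp
  then have "(- 1) ^ n * (\<Sum>y\<in>Y. (- 1) ^ card {x \<in> Y. x < y} * a r y * Delta a (Y - {y})) = 0"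
    by (simp add: sum_distrib_left power_add mult_ac)
  then show ?thesis by simp
qed

text \<open>Expand \<open>\<Delta>\<^bsub>L \<union> {y}\<^esub>\<close> along the column \<open>y\<close> and collect, for each row, the coefficient of its
  cofactor: what is left is the expansion of a determinant of size \<open>card Y\<close> with a repeated row.\<close>

theorem pluecker_relation:
  assumes "finite L" "finite Y" "card Y = card L + 2"
  shows "(\<Sum>y\<in>Y - L. (- 1) ^ (card {x \<in> Y. x < y} + card {x \<in> L. x < y})
           * Delta a (insert y L) * Delta a (Y - {y})) = 0"
proof -
  let ?l = "\<lambda>y. \<Sum>i<Suc (card L). (- 1) ^ i * a i y * Delta (skip_row i a) L"
  let ?s = "\<lambda>y. (- 1) ^ card {x \<in> Y. x < y} :: real"
  have l0: "?l y = 0" if "y \<in> L" for y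
    using Delta_expand_column_repeated[OF assms(1) that] .
  have l1: "?l y = (- 1) ^ card {x \<in> L. x < y} * Delta a (insert y L)" if "y \<notin> L" for y
    unfolding Delta_expand_column[OF assms(1) that] by (simp add: mult.assoc[symmetric] power_mult_distrib[symmetric])
  have "0 = (\<Sum>i<Suc (card L). (- 1) ^ i * Delta (skip_row i a) L
          * (\<Sum>y\<in>Y. ?s y * a i y * Delta a (Y - {y})))"
    using Delta_expand_alien_row[OF assms(2), of "Suc (card L)"] assms(3) by simp
  also have "\<dots> = (\<Sum>i<Suc (card L). \<Sum>y\<in>Y. ?s y * Delta a (Y - {y})
          * ((- 1) ^ i * a i y * Delta (skip_row i a) L))"
    by (simp only: sum_distrib_left mult_ac)
  also have "\<dots> = (\<Sum>y\<in>Y. ?s y * Delta a (Y - {y}) * ?l y)"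
    by (subst sum.swap) (simp only: sum_distrib_left)
  also have "\<dots> = (\<Sum>y\<in>Y - L. ?s y * Delta a (Y - {y}) * ?l y)"
    by (rule sum.mono_neutral_right) (use assms l0 in auto)
  also have "\<dots> = (\<Sum>y\<in>Y - L. (- 1) ^ (card {x \<in> Y. x < y} + card {x \<in> L. x < y})
           * Delta a (insert y L) * Delta a (Y - {y}))"
    by (rule sum.cong) (auto simp: l1 power_add simp del: sum.lessThan_Suc)
  finally show ?thesis by simp
qed

lemma three_term_relation:
  fixes p q r s :: nat
  assumes "finite S" "p < q" "q < r" "r < s" "{p, q, r, s} \<inter> S = {}"
  shows "Delta a (insert p (insert r S)) * Delta a (insert q (insert s S)) =
    Delta a (insert p (insert q S)) * Delta a (insert r (insert s S)) +
    Delta a (insert p (insert s S)) * Delta a (insert q (insert r S))"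
proof -
  let ?L = "insert p S" and ?Y = "insert q (insert r (insert s S))"
  have pq: "p < q" "p < r" "p < s" using assms by simp_all
  have D: "?Y - ?L = {q, r, s}" using assms by auto
  have c: "{x \<in> ?L. x < y} = insert p {x \<in> S. x < y}" if "p < y" for y using that by auto
  have cL: "card {x \<in> ?L. x < y} = Suc (card {x \<in> S. x < y})" if "p < y" for y
    unfolding c[OF that] using assms by simp
  have cq: "{x \<in> ?Y. x < q} = {x \<in> S. x < q}" using assms by auto
  have cr: "{x \<in> ?Y. x < r} = insert q {x \<in> S. x < r}" using assms by auto
  have cs: "{x \<in> ?Y. x < s} = insert q (insert r {x \<in> S. x < s})" using assms by auto
  have "(\<Sum>y\<in>?Y - ?L. (- 1) ^ (card {x \<in> ?Y. x < y} + card {x \<in> ?L. x < y})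
           * Delta a (insert y ?L) * Delta a (?Y - {y})) = 0"
    by (rule pluecker_relation) (use assms in auto)
  moreover have "?Y - {q} = insert r (insert s S)" "?Y - {r} = insert q (insert s S)"
    "?Y - {s} = insert q (insert r S)" using assms by auto
  moreover have "(- 1 :: real) ^ (card {x \<in> ?Y. x < q} + card {x \<in> ?L. x < q}) = - 1"
    "(- 1 :: real) ^ (card {x \<in> ?Y. x < r} + card {x \<in> ?L. x < r}) = 1"
    "(- 1 :: real) ^ (card {x \<in> ?Y. x < s} + card {x \<in> ?L. x < s}) = - 1"
    unfolding cq cr cs cL[OF pq(1)] cL[OF pq(2)] cL[OF pq(3)]
    using assms by (simp_all flip: mult_2)
  moreover have "sum f {q, r, s} = f q + (f r + f s)" for f :: "nat \<Rightarrow> real" using assms by simp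
  ultimately show ?thesis unfolding D
    by (simp only: insert_commute[of p])
qed

section \<open>Inserting elements without creating small minors\<close>

definition between :: "nat \<Rightarrow> nat \<Rightarrow> nat \<Rightarrow> bool" where
  "between j c x \<longleftrightarrow> j < x \<and> x < c \<or> c < x \<and> x < j"

text \<open>Exponents for the powers of a large parameter attached to the labels \<open>j < M\<close>: they are positive
  and pairwise distinct off \<open>c\<close>, and on either side of \<open>c\<close> they grow as \<open>j\<close> approaches \<open>c\<close>.\<close>

definition nearness :: "nat \<Rightarrow> nat \<Rightarrow> nat \<Rightarrow> nat" where
  "nearness M c j = (if j < c then M + j else M - j)"

definition jointly_smallest :: "nat \<Rightarrow> nat set \<Rightarrow> nat set \<Rightarrow> nat set \<Rightarrow> bool" where
  "jointly_smallest k X I J \<longleftrightarrow> (\<exists>a. (\<forall>K \<in> nsets X k. 0 < Delta a K) \<and>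
     Delta a I = Delta a J \<and> (\<forall>K \<in> nsets X k. Delta a I \<le> Delta a K))"

text \<open>With \<open>m = e j0 - 1\<close> and \<open>B\<close> the sum of the other \<open>\<bar>q j\<bar>\<close>, the sum is at least \<open>(q j0 * t - B) * t ^ m\<close>
  for \<open>t \<ge> 1\<close>.\<close>

lemma leading_power_dominates:
  fixes e :: "nat \<Rightarrow> nat" and q :: "nat \<Rightarrow> real"
  assumes "finite F" "j0 \<in> F" "0 < q j0" "1 \<le> e j0" "\<And>j. j \<in> F \<Longrightarrow> j \<noteq> j0 \<Longrightarrow> e j < e j0"
  shows "eventually (\<lambda>t. N \<le> (\<Sum>j\<in>F. q j * t ^ e j)) at_top"
proof -
  define m where "m = e j0 - 1"
  define B where "B = (\<Sum>j\<in>F - {j0}. \<bar>q j\<bar>)"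
  have B: "0 \<le> B" unfolding B_def by (rule sum_nonneg) simp
  have "N \<le> (\<Sum>j\<in>F. q j * t ^ e j)" if t: "1 \<le> t" "(B + \<bar>N\<bar>) / q j0 \<le> t" for t
  proof -
    have "- (\<bar>q j\<bar> * t ^ m) \<le> q j * t ^ e j" if j: "j \<in> F - {j0}" for j
    proof -
      have "e j \<le> m" using assms(4,5) j unfolding m_def by fastforce
      then have "t ^ e j \<le> t ^ m" using t(1) by (rule power_increasing)
      then have "\<bar>q j\<bar> * t ^ e j \<le> \<bar>q j\<bar> * t ^ m" by (rule mult_left_mono) simp
      moreover have "- (\<bar>q j\<bar> * t ^ e j) \<le> q j * t ^ e j"
        using mult_right_mono[of "- \<bar>q j\<bar>" "q j" "t ^ e j"] t(1) by simp
      ultimately show ?thesis by linarith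
    qed
    then have "(\<Sum>j\<in>F - {j0}. - (\<bar>q j\<bar> * t ^ m)) \<le> (\<Sum>j\<in>F - {j0}. q j * t ^ e j)"
      by (rule sum_mono)
    then have 1: "- (B * t ^ m) \<le> (\<Sum>j\<in>F - {j0}. q j * t ^ e j)"
      by (simp add: B_def sum_negf sum_distrib_right)
    have 2: "q j0 * t ^ e j0 = q j0 * t * t ^ m"
      unfolding m_def using assms(4) by (simp add: power_eq_if mult_ac)
    have 3: "\<bar>N\<bar> \<le> q j0 * t - B"
      using t(2) assms(3) by (simp add: field_simps)
    have "N \<le> (q j0 * t - B) * 1" using 3 by simp
    also have "\<dots> \<le> (q j0 * t - B) * t ^ m"
      by (rule mult_left_mono) (use 3 t(1) in \<open>auto intro: one_le_power\<close>)
    also have "\<dots> \<le> q j0 * t ^ e j0 + (\<Sum>j\<in>F - {j0}. q j * t ^ e j)"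
      unfolding 2 using 1 by (simp add: algebra_simps)
    also have "\<dots> = (\<Sum>j\<in>F. q j * t ^ e j)" using assms(1,2) by (simp add: sum.remove)
    finally show ?thesis .
  qed
  then show ?thesis unfolding eventually_at_top_linorder
    by (intro exI[of _ "max 1 ((B + \<bar>N\<bar>) / q j0)"]) auto
qed

text \<open>The term with the largest exponent belongs to a \<open>j\<close> such that no element of \<open>F\<close> lies between \<open>j\<close> and
  \<open>c\<close>; its sign is therefore positive. Every minor created by an insertion below is a sum of this
  form.\<close>

lemma nearest_term_dominates:
  assumes "finite F" "F \<noteq> {}" "c \<notin> F" "\<And>j. j \<in> F \<Longrightarrow> j < M" "\<And>j. j \<in> F \<Longrightarrow> 0 < p j"
  shows "eventually (\<lambda>t::real. N \<le>
    (\<Sum>j\<in>F. (- 1) ^ card {x \<in> F. between j c x} * t ^ nearness M c j * p j)) at_top"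
proof -
  let ?e = "nearness M c"
  have "Max (?e ` F) \<in> ?e ` F" using assms(1,2) by (intro Max_in) auto
  then obtain j0 where j0: "j0 \<in> F" "?e j0 = Max (?e ` F)" by auto
  then have mx: "?e j \<le> ?e j0" if "j \<in> F" for j using assms(1) that by simp
  note j0 = j0(1)
  have inj: "?e j \<noteq> ?e j0" if "j \<in> F" "j \<noteq> j0" for j
    using assms(4)[OF that(1)] assms(4)[OF j0] that assms(3) j0
    by (auto simp: nearness_def split: if_splits)
  have none: "{x \<in> F. between j0 c x} = {}"
    using mx assms(4)[OF j0] assms(4) by (fastforce simp: between_def nearness_def split: if_splits)
  have "eventually (\<lambda>t. N \<le> (\<Sum>j\<in>F. ((- 1) ^ card {x \<in> F. between j c x} * p j) * t ^ ?e j)) at_top"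
  proof (rule leading_power_dominates[OF assms(1) j0])
    show "0 < (- 1) ^ card {x \<in> F. between j0 c x} * p j0" unfolding none using assms(5)[OF j0] by simp
    show "1 \<le> ?e j0" using assms(4)[OF j0] by (auto simp: nearness_def)
    show "?e j < ?e j0" if "j \<in> F" "j \<noteq> j0" for j using mx inj that by (meson le_neq_implies_less)
  qed
  then show ?thesis by (simp add: mult_ac)
qed

lemma sign_between:
  assumes "finite L" "j \<notin> L" "c \<notin> L"
  shows "(- 1 :: real) ^ card {x \<in> L. x < c} * (- 1) ^ card {x \<in> L. x < j} = (- 1) ^ card {x \<in> L. between j c x}"
proof -
  have *: "(- 1 :: real) ^ card {x \<in> L. x < c} * (- 1) ^ card {x \<in> L. x < j} = (- 1) ^ card {x \<in> L. between j c x}"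
    if "j \<le> c" "j \<notin> L" for j c
  proof -
    have e: "{x \<in> L. x < c} = {x \<in> L. x < j} \<union> {x \<in> L. between j c x}"
      using that by (auto simp: between_def not_less le_less)
    have "card {x \<in> L. x < c} = card {x \<in> L. x < j} + card {x \<in> L. between j c x}"
      unfolding e by (rule card_Un_disjoint) (use assms(1) that in \<open>auto simp: between_def\<close>)
    then show ?thesis by (simp add: power_add flip: power_mult_distrib)
  qed
  have "between j c = between c j" by (auto simp: between_def fun_eq_iff)
  then show ?thesis using *[of j c] *[of c j] assms by (cases "j \<le> c") (auto simp: mult.commute)
qed

text \<open>The new column is \<open>\<Sum>\<^sub>j (- 1)\<^bsup>d j\<^esup> t\<^bsup>e j\<^esup> a\<^sub>j\<close>, where \<open>d j\<close> counts the labels strictly between \<open>j\<close> and \<open>c\<close> and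
  \<open>e\<close> is \<open>nearness\<close>. In a minor with columns \<open>L \<union> {c}\<close> the summands with \<open>j \<in> L\<close> vanish, and moving
  \<open>a\<^sub>j\<close> from the place of \<open>c\<close> to its own place passes the elements of \<open>L\<close> in between. This leaves
  the sign that counts the elements of \<open>X - L\<close> between \<open>j\<close> and \<open>c\<close>, so the minor tends to infinity
  with \<open>t\<close>.\<close>

lemma jointly_smallest_insert_outside:
  assumes js: "jointly_smallest k X I J" and X: "finite X" "c \<notin> X"
    and IJ: "I \<in> nsets X k" "J \<in> nsets X k"
  shows "jointly_smallest k (insert c X) I J"
proof -
  obtain a where a: "\<And>K. K \<in> nsets X k \<Longrightarrow> 0 < Delta a K" "Delta a I = Delta a J"
    "\<And>K. K \<in> nsets X k \<Longrightarrow> Delta a I \<le> Delta a K"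
    using js unfolding jointly_smallest_def by blast
  define M where "M = Suc (Max X)"
  have M: "j < M" if "j \<in> X" for j using that X(1) by (simp add: M_def less_Suc_eq_le)
  define b where "b t i x = (if x = c
    then \<Sum>j\<in>X. (- 1) ^ card {x \<in> X. between j c x} * t ^ nearness M c j * a i j
    else a i x)" for t i x
  have old: "Delta (b t) K = Delta a K" if "K \<in> nsets X k" for t K
    using that X by (intro Delta_cong) (auto simp: b_def nsets_def)
  have new: "Delta (b t) (insert c L) = (\<Sum>j\<in>X - L.
      (- 1) ^ card {x \<in> X - L. between j c x} * t ^ nearness M c j * Delta a (insert j L))"
    if L: "L \<subseteq> X" for t L
  proof -
    have fL: "finite L" "c \<notin> L" using L X finite_subset by auto
    let ?l = "\<lambda>j. \<Sum>i<Suc (card L). (- 1) ^ i * a i j * Delta (skip_row i a) L"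
    have sk: "Delta (skip_row i (b t)) L = Delta (skip_row i a) L" for i
      using fL by (intro Delta_cong) (auto simp: skip_row_def b_def)
    have "Delta (b t) (insert c L) = (- 1) ^ card {x \<in> L. x < c} *
        (\<Sum>i<Suc (card L). (- 1) ^ i * b t i c * Delta (skip_row i a) L)"
      unfolding Delta_expand_column[OF fL] sk ..
    also have "(\<Sum>i<Suc (card L). (- 1) ^ i * b t i c * Delta (skip_row i a) L) =
        (\<Sum>i<Suc (card L). \<Sum>j\<in>X. (- 1) ^ card {x \<in> X. between j c x} * t ^ nearness M c j
          * ((- 1) ^ i * a i j * Delta (skip_row i a) L))"
      by (simp add: b_def sum_distrib_left sum_distrib_right mult_ac del: sum.lessThan_Suc)
    also have "\<dots> = (\<Sum>j\<in>X. (- 1) ^ card {x \<in> X. between j c x} * t ^ nearness M c j * ?l j)"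
      by (subst sum.swap) (simp only: sum_distrib_left)
    also have "\<dots> = (\<Sum>j\<in>X - L. (- 1) ^ card {x \<in> X. between j c x} * t ^ nearness M c j * ?l j)"
      by (rule sum.mono_neutral_right)
         (use X Delta_expand_column_repeated[OF fL(1)] in \<open>auto simp del: sum.lessThan_Suc\<close>)
    also have "(- 1) ^ card {x \<in> L. x < c} * \<dots> = (\<Sum>j\<in>X - L.
      (- 1) ^ card {x \<in> X - L. between j c x} * t ^ nearness M c j * Delta a (insert j L))"
      unfolding sum_distrib_left[of _ _ "X - L"]
    proof (rule sum.cong[OF refl])
      fix j assume j: "j \<in> X - L"
      have "{x \<in> X. between j c x} = {x \<in> L. between j c x} \<union> {x \<in> X - L. between j c x}"
        using L by auto
      then have "card {x \<in> X. between j c x} = card {x \<in> L. between j c x} + card {x \<in> X - L. between j c x}"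
        using fL X(1) by (simp add: card_Un_disjoint disjoint_iff)
      then have s: "(- 1 :: real) ^ card {x \<in> X. between j c x} =
          (- 1) ^ card {x \<in> L. x < c} * (- 1) ^ card {x \<in> L. x < j} * (- 1) ^ card {x \<in> X - L. between j c x}"
        using sign_between[of L j c] fL j by (simp add: power_add)
      have l: "?l j = (- 1) ^ card {x \<in> L. x < j} * Delta a (insert j L)"
        using Delta_expand_column[of L j a] j fL
        by (simp add: mult.assoc[symmetric] power_mult_distrib[symmetric] del: sum.lessThan_Suc)
      have sq: "(- 1 :: real) ^ n * ((- 1) ^ n * z) = z" for n z
        by (simp add: mult.assoc[symmetric] power_mult_distrib[symmetric])
      show "(- 1) ^ card {x \<in> L. x < c} * ((- 1) ^ card {x \<in> X. between j c x} * t ^ nearness M c j * ?l j)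
        = (- 1) ^ card {x \<in> X - L. between j c x} * t ^ nearness M c j * Delta a (insert j L)"
        unfolding s l by (simp add: sq mult.assoc mult.left_commute[of "(- 1) ^ card {x \<in> L. x < j}"])
    qed
    finally show ?thesis .
  qed
  have "eventually (\<lambda>t. Delta a I \<le> Delta (b t) K) at_top"
    if K: "K \<in> {K \<in> nsets (insert c X) k. c \<in> K}" for K
  proof -
    define L where "L = K - {c}"
    have L: "insert c L = K" "L \<subseteq> X" "finite L" "c \<notin> L"
      using K by (auto simp: L_def nsets_def)
    moreover have "Suc (card L) = k"
      using K card.remove[of K c] by (simp only: L_def nsets_def mem_Collect_eq)
    ultimately have L: "insert c L = K" "L \<subseteq> X" "finite L" "c \<notin> L" "Suc (card L) = k"
      by simp_all
    have "\<not> X \<subseteq> L"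
    proof
      assume "X \<subseteq> L"
      then have "card I \<le> card L" using IJ(1) L(3) by (auto simp: nsets_def intro: card_mono)
      then show False using IJ(1) L(5) by (simp add: nsets_def)
    qed
    then have "eventually (\<lambda>t. Delta a I \<le> (\<Sum>j\<in>X - L. (- 1) ^ card {x \<in> X - L. between j c x}
        * t ^ nearness M c j * Delta a (insert j L))) at_top"
      using X L M a(1) by (intro nearest_term_dominates) (auto simp: nsets_def)
    then show ?thesis using new[OF L(2)] L(1) by simp
  qed
  then have "eventually (\<lambda>t. \<forall>K \<in> {K \<in> nsets (insert c X) k. c \<in> K}. Delta a I \<le> Delta (b t) K) at_top"
    using X(1) by (intro eventually_ball_finite) (auto simp: finite_imp_finite_nsets)
  then obtain t where t: "\<And>K. K \<in> nsets (insert c X) k \<Longrightarrow> c \<in> K \<Longrightarrow> Delta a I \<le> Delta (b t) K"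
    using eventually_happens'[OF trivial_limit_at_top_linorder] by blast
  have ge: "Delta (b t) I \<le> Delta (b t) K" if "K \<in> nsets (insert c X) k" for K
  proof (cases "c \<in> K")
    case True then show ?thesis using t that old[OF IJ(1)] by simp
  next
    case False
    then have "K \<in> nsets X k" using that by (auto simp: nsets_def)
    then show ?thesis using old IJ(1) a(3) by simp
  qed
  have "0 < Delta (b t) I" using old[OF IJ(1)] a(1)[OF IJ(1)] by simp
  then show ?thesis unfolding jointly_smallest_def
    using ge old IJ a(2) by (intro exI[of _ "b t"]) (force intro: less_le_trans)
qed

lemma minor_scale_columns:
  "minor (\<lambda>i x. s x * a i x) xs = (\<Prod>x\<leftarrow>xs. s x) * minor a xs"
proof -
  let ?n = "length xs"
  let ?A = "mat ?n ?n (\<lambda>(i, j). a i (xs ! j))" and ?D = "mat ?n ?n (\<lambda>(i, j). if i = j then s (xs ! j) else 0)"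
  have "mat ?n ?n (\<lambda>(i, j). s (xs ! j) * a i (xs ! j)) = ?A * ?D"
    by (intro eq_matI) (auto simp: scalar_prod_def if_distrib cong: if_cong)
  then have "minor (\<lambda>i x. s x * a i x) xs = det ?A * det ?D"
    unfolding minor_def by (simp add: det_mult[of _ ?n])
  also have "det ?D = prod_list (diag_mat ?D)"
    by (rule det_upper_triangular) auto
  also have "diag_mat ?D = map s xs" by (rule nth_equalityI) (auto simp: diag_mat_def)
  finally show ?thesis by (simp add: minor_def)
qed

lemma Delta_scale_columns:
  assumes "finite K"
  shows "Delta (\<lambda>i x. s x * a i x) K = (\<Prod>x\<in>K. s x) * Delta a K"
  unfolding Delta_def minor_scale_columns
  using prod.distinct_set_conv_list[of "sorted_list_of_set K" s] assms by simp

text \<open>Dually to the previous construction, there is a new last row with entries \<open>t\<^bsup>e j\<^esup>\<close>, and the new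
  column is the unit vector of that row. Changing the signs of the old entries to the right of \<open>c\<close>
  compensates the sign of moving \<open>c\<close> to the last place, so the minors with \<open>c\<close> are the old minors.
  Expanding a minor without \<open>c\<close> along the new row gives a sum in which the term nearest to \<open>c\<close> is
  positive and dominates.\<close>

lemma jointly_smallest_insert_common:
  assumes js: "jointly_smallest k X I J" and X: "finite X" "c \<notin> X"
    and IJ: "I \<in> nsets X k" "J \<in> nsets X k"
  shows "jointly_smallest (Suc k) (insert c X) (insert c I) (insert c J)"
proof -
  obtain a where a: "\<And>K. K \<in> nsets X k \<Longrightarrow> 0 < Delta a K" "Delta a I = Delta a J"
    "\<And>K. K \<in> nsets X k \<Longrightarrow> Delta a I \<le> Delta a K"
    using js unfolding jointly_smallest_def by blast
  define M where "M = Suc (Max X)"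
  have M: "j < M" if "j \<in> X" for j using that X(1) by (simp add: M_def less_Suc_eq_le)
  define s :: "nat \<Rightarrow> real" where "s x = (if c < x then - 1 else 1)" for x
  define b where "b t i x = (if x = c then (if i = k then 1 else 0)
    else if i = k then t ^ nearness M c x else s x * a i x)" for t :: real and i x
  have flip: "(\<Prod>x\<in>L. s x) = (- 1) ^ card {x \<in> L. c < x}" if "finite L" for L
    unfolding s_def using that
    by (subst prod.If_cases) (auto simp: Int_def)
  have low: "Delta (b t) L = (- 1) ^ card {x \<in> L. c < x} * Delta a L" if "L \<subseteq> X" "card L = k" for t L
  proof -
    have "finite L" using that X finite_subset by auto
    moreover have "Delta (b t) L = Delta (\<lambda>i x. s x * a i x) L"
      using that X calculation by (intro Delta_cong) (auto simp: b_def)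
    ultimately show ?thesis by (simp add: Delta_scale_columns flip)
  qed
  have old: "Delta (b t) (insert c L) = Delta a L" if L: "L \<subseteq> X" "card L = k" for t L
  proof -
    have fL: "finite L" "c \<notin> L" using L X finite_subset by auto
    have e: "{x \<in> L. x < c} \<union> {x \<in> L. c < x} = L" using fL(2) by auto (metis linorder_neqE_nat)
    have "card ({x \<in> L. x < c} \<union> {x \<in> L. c < x}) = card {x \<in> L. x < c} + card {x \<in> L. c < x}"
      by (rule card_Un_disjoint) (use fL in auto)
    then have cd: "k = card {x \<in> L. x < c} + card {x \<in> L. c < x}" unfolding e using L by simp
    have sk: "Delta (skip_row k (b t)) L = Delta (b t) L"
      using fL L by (intro Delta_cong) (auto simp: skip_row_def)
    have "Delta (b t) (insert c L) = (- 1) ^ card {x \<in> L. x < c} *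
        (\<Sum>i<Suc k. (- 1) ^ i * b t i c * Delta (skip_row i (b t)) L)"
      unfolding Delta_expand_column[OF fL] L(2) ..
    also have "(\<Sum>i<Suc k. (- 1) ^ i * b t i c * Delta (skip_row i (b t)) L) = (- 1) ^ k * Delta (b t) L"
      by (simp add: b_def[of _ _ c] sk)
    moreover have "(- 1 :: real) ^ k = (- 1) ^ card {x \<in> L. x < c} * (- 1) ^ card {x \<in> L. c < x}"
      using cd by (metis power_add)
    moreover have sq: "(- 1 :: real) ^ n * ((- 1) ^ n * z) = z" for n z
      by (simp add: mult.assoc[symmetric] flip: power_mult_distrib)
    ultimately show ?thesis unfolding low[OF L]
      by (simp add: mult.assoc mult.left_commute[of "(- 1) ^ card {x \<in> L. c < x}"] sq)
  qed
  have new: "Delta (b t) K = (\<Sum>j\<in>K.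
      (- 1) ^ card {x \<in> K. between j c x} * t ^ nearness M c j * Delta a (K - {j}))"
    if K: "K \<subseteq> X" "card K = Suc k" for t K
  proof -
    have fK: "finite K" "c \<notin> K" using K X finite_subset by auto
    have "Delta (b t) K = (\<Sum>j\<in>K. (- 1) ^ (k + card {x \<in> K. x < j}) * b t k j * Delta (b t) (K - {j}))"
      by (rule Delta_expand_last_row[OF fK(1) K(2)])
    also have "\<dots> = (\<Sum>j\<in>K.
      (- 1) ^ card {x \<in> K. between j c x} * t ^ nearness M c j * Delta a (K - {j}))"
    proof (rule sum.cong[OF refl])
      fix j assume j: "j \<in> K"
      let ?L = "K - {j}"
      have L: "?L \<subseteq> X" "card ?L = k" using j K fK by auto
      have e: "{x \<in> ?L. x < c} \<union> {x \<in> ?L. c < x} = ?L" using fK(2) by auto (metis linorder_neqE_nat)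
      have "card ({x \<in> ?L. x < c} \<union> {x \<in> ?L. c < x}) = card {x \<in> ?L. x < c} + card {x \<in> ?L. c < x}"
        by (rule card_Un_disjoint) (use fK in auto)
      then have cd: "k = card {x \<in> ?L. x < c} + card {x \<in> ?L. c < x}" unfolding e using L by simp
      have r: "{x \<in> K. x < j} = {x \<in> ?L. x < j}" "{x \<in> K. between j c x} = {x \<in> ?L. between j c x}"
        by (auto simp: between_def)
      have "(- 1 :: real) ^ (k + card {x \<in> K. x < j}) * (- 1) ^ card {x \<in> ?L. c < x} =
          (- 1) ^ card {x \<in> ?L. x < c} * (- 1) ^ card {x \<in> ?L. x < j}"
        unfolding r by (subst (1) cd) (simp add: power_add mult_ac flip: power_mult_distrib)
      also have "\<dots> = (- 1) ^ card {x \<in> K. between j c x}"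
        unfolding r using sign_between[of ?L j c] fK by simp
      finally have sg: "(- 1 :: real) ^ (k + card {x \<in> K. x < j}) * (- 1) ^ card {x \<in> ?L. c < x} =
          (- 1) ^ card {x \<in> K. between j c x}" .
      have bk: "b t k j = t ^ nearness M c j" using j fK by (auto simp: b_def)
      show "(- 1) ^ (k + card {x \<in> K. x < j}) * b t k j * Delta (b t) (K - {j}) =
        (- 1) ^ card {x \<in> K. between j c x} * t ^ nearness M c j * Delta a (K - {j})"
        unfolding low[OF L] bk sg[symmetric] by (simp add: mult_ac)
    qed
    finally show ?thesis .
  qed
  have "eventually (\<lambda>t. Delta a I \<le> Delta (b t) K) at_top" if K: "K \<in> nsets X (Suc k)" for K
  proof -
    have K': "K \<subseteq> X" "card K = Suc k" "finite K" "K \<noteq> {}" using K by (auto simp: nsets_def)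
    have pos: "0 < Delta a (K - {j})" if "j \<in> K" for j
      using K' that by (intro a(1)) (auto simp: nsets_def)
    have "eventually (\<lambda>t. Delta a I \<le> (\<Sum>j\<in>K. (- 1) ^ card {x \<in> K. between j c x}
        * t ^ nearness M c j * Delta a (K - {j}))) at_top"
      using X K' M pos by (intro nearest_term_dominates) auto
    then show ?thesis using new[OF K'(1,2)] by simp
  qed
  then have "eventually (\<lambda>t. \<forall>K \<in> nsets X (Suc k). Delta a I \<le> Delta (b t) K) at_top"
    using X(1) by (intro eventually_ball_finite) (auto simp: finite_imp_finite_nsets)
  then obtain t where t: "\<And>K. K \<in> nsets X (Suc k) \<Longrightarrow> Delta a I \<le> Delta (b t) K"
    using eventually_happens'[OF trivial_limit_at_top_linorder] by blast
  have old': "Delta (b t) (insert c L) = Delta a L" if "L \<in> nsets X k" for L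
    using old that by (auto simp: nsets_def)
  have ge: "Delta (b t) (insert c I) \<le> Delta (b t) K" if K: "K \<in> nsets (insert c X) (Suc k)" for K
  proof (cases "c \<in> K")
    case True
    then have "K - {c} \<in> nsets X k" using K by (auto simp: nsets_def)
    then show ?thesis using old'[of "K - {c}"] old'[OF IJ(1)] a(3) True by (simp add: insert_absorb)
  next
    case False
    then have "K \<in> nsets X (Suc k)" using K by (auto simp: nsets_def)
    then show ?thesis using t old'[OF IJ(1)] by simp
  qed
  have "0 < Delta (b t) (insert c I)" using old'[OF IJ(1)] a(1)[OF IJ(1)] by simp
  then show ?thesis unfolding jointly_smallest_def
    using ge old' IJ a(2) by (intro exI[of _ "b t"]) (force intro: less_le_trans)
qed

lemma jointly_smallest_extend:
  assumes "jointly_smallest r (I - J \<union> (J - I)) (I - J) (J - I)"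
    and "finite X" "I \<in> nsets X k" "J \<in> nsets X k" "card (I - J) = r"
  shows "jointly_smallest k X I J"
proof -
  have f: "finite I" "finite J" "I \<subseteq> X" "J \<subseteq> X" "card I = k" "card J = k"
    using assms(3,4) by (auto simp: nsets_def)
  have rJ: "card (J - I) = r"
    using assms(5) f card_Diff_subset_Int[of I J] card_Diff_subset_Int[of J I] by (simp add: Int_commute)
  have common: "jointly_smallest (r + card C) (I - J \<union> (J - I) \<union> C) (I - J \<union> C) (J - I \<union> C)"
    if "finite C" "C \<subseteq> I \<inter> J" for C
    using that
  proof (induction C rule: finite_induct)
    case empty show ?case using assms(1) by simp
  next
    case (insert c C)
    have "jointly_smallest (Suc (r + card C)) (insert c (I - J \<union> (J - I) \<union> C))
        (insert c (I - J \<union> C)) (insert c (J - I \<union> C))"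
    proof (rule jointly_smallest_insert_common)
      show "I - J \<union> C \<in> nsets (I - J \<union> (J - I) \<union> C) (r + card C)"
        "J - I \<union> C \<in> nsets (I - J \<union> (J - I) \<union> C) (r + card C)"
        using insert f card_Un_disjoint[of "I - J" C] card_Un_disjoint[of "J - I" C] assms(5) rJ
        by (auto simp: nsets_def disjoint_iff subset_iff)
    qed (use insert f in auto)
    then show ?case using insert by simp
  qed
  have "I - J \<union> (J - I) \<union> I \<inter> J = I \<union> J" "I - J \<union> I \<inter> J = I" "J - I \<union> I \<inter> J = J" by auto
  moreover have "r + card (I \<inter> J) = k"
    using assms(5) f by (metis card_Diff_subset_Int card_mono finite_Int inf_le1 le_add_diff_inverse2)
  ultimately have base: "jointly_smallest k (I \<union> J) I J"
    using common[of "I \<inter> J"] f by simp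
  have "jointly_smallest k (I \<union> J \<union> D) I J" if "finite D" for D
    using that
  proof (induction D rule: finite_induct)
    case empty show ?case using base by simp
  next
    case (insert d D)
    show ?case
    proof (cases "d \<in> I \<union> J")
      case True
      then have "I \<union> J \<union> insert d D = I \<union> J \<union> D" by auto
      then show ?thesis using insert.IH by simp
    next
      case False
      have "jointly_smallest k (insert d (I \<union> J \<union> D)) I J"
        by (rule jointly_smallest_insert_outside) (use insert f False in \<open>auto simp: nsets_def\<close>)
      then show ?thesis by simp
    qed
  qed
  from this[OF assms(2)] show ?thesis using f by (simp add: Un_absorb1 Un_least)
qed

section \<open>Inequalities between products of minors\<close>

text \<open>For distinct elements, \<open>between a c b \<noteq> between a c d\<close> says that the pairs \<open>{a, c}\<close> and \<open>{b, d}\<close>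
  cross, a notion invariant under rotation and reflection of the cyclic order. The small side
  is therefore either of the two ways to split \<open>{a, b, c, d}\<close> into non-crossing pairs.\<close>

definition strictly_exchanging :: "(nat set \<Rightarrow> real) \<Rightarrow> nat set \<Rightarrow> nat \<Rightarrow> bool" where
  "strictly_exchanging f X k \<longleftrightarrow> (\<forall>K \<in> nsets X k. 0 < f K) \<and>
     (\<forall>S a b c d. finite S \<longrightarrow> card S + 2 = k \<longrightarrow> insert a (insert b (insert c (insert d S))) \<subseteq> X \<longrightarrow>
        distinct [a, b, c, d] \<longrightarrow> {a, b, c, d} \<inter> S = {} \<longrightarrow> between a c b \<noteq> between a c d \<longrightarrow>
        f (insert a (insert b S)) * f (insert c (insert d S))
          < f (insert a (insert c S)) * f (insert b (insert d S)))"

lemma strictly_exchangingD: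
  assumes "strictly_exchanging f X k"
  shows "K \<in> nsets X k \<Longrightarrow> 0 < f K"
    and "finite S \<Longrightarrow> card S + 2 = k \<Longrightarrow> insert a (insert b (insert c (insert d S))) \<subseteq> X \<Longrightarrow>
      distinct [a, b, c, d] \<Longrightarrow> {a, b, c, d} \<inter> S = {} \<Longrightarrow> between a c b \<noteq> between a c d \<Longrightarrow>
      f (insert a (insert b S)) * f (insert c (insert d S))
        < f (insert a (insert c S)) * f (insert b (insert d S))"
  using assms unfolding strictly_exchanging_def by blast+

text \<open>Both products on the right of the three-term relation are positive, and each of them is smaller
  than the left side. Two crossing pairs admit eight linear orders of the four labels.\<close>

lemma Delta_strictly_exchanging:
  assumes "\<And>K. K \<in> nsets X k \<Longrightarrow> 0 < Delta a K"
  shows "strictly_exchanging (Delta a) X k"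
proof -
  have "Delta a (insert w (insert x S)) * Delta a (insert y (insert z S))
      < Delta a (insert w (insert y S)) * Delta a (insert x (insert z S))"
    if S: "finite S" "card S + 2 = k" and sub: "insert w (insert x (insert y (insert z S))) \<subseteq> X"
      and d: "distinct [w, x, y, z]" "{w, x, y, z} \<inter> S = {}" and cr: "between w y x \<noteq> between w y z"
    for S w x y z
  proof -
    have pos: "0 < Delta a (insert p (insert q S))"
      if "p \<in> {w, x, y, z}" "q \<in> {w, x, y, z}" "p \<noteq> q" for p q
      using that S sub d by (intro assms) (auto simp: nsets_def)
    have T1: "Delta a (insert p (insert q S)) * Delta a (insert r (insert s S))
        < Delta a (insert p (insert r S)) * Delta a (insert q (insert s S))"
      and T2: "Delta a (insert p (insert s S)) * Delta a (insert q (insert r S))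
        < Delta a (insert p (insert r S)) * Delta a (insert q (insert s S))"
      if "p < q" "q < r" "r < s" "{p, q, r, s} = {w, x, y, z}" for p q r s
    proof -
      have "p \<in> {w, x, y, z}" "q \<in> {w, x, y, z}" "r \<in> {w, x, y, z}" "s \<in> {w, x, y, z}"
        using that(4) by auto
      then have "0 < Delta a (insert p (insert q S)) * Delta a (insert r (insert s S))"
        "0 < Delta a (insert p (insert s S)) * Delta a (insert q (insert r S))"
        using that pos by (auto intro!: mult_pos_pos)
      moreover have "Delta a (insert p (insert r S)) * Delta a (insert q (insert s S)) =
        Delta a (insert p (insert q S)) * Delta a (insert r (insert s S)) +
        Delta a (insert p (insert s S)) * Delta a (insert q (insert r S))"
        using that S d by (intro three_term_relation) auto
      ultimately show "Delta a (insert p (insert q S)) * Delta a (insert r (insert s S))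
          < Delta a (insert p (insert r S)) * Delta a (insert q (insert s S))"
        "Delta a (insert p (insert s S)) * Delta a (insert q (insert r S))
          < Delta a (insert p (insert r S)) * Delta a (insert q (insert s S))" by auto
    qed
    consider "w < x \<and> x < y \<and> y < z" | "w < z \<and> z < y \<and> y < x" | "y < x \<and> x < w \<and> w < z"
      | "y < z \<and> z < w \<and> w < x" | "x < w \<and> w < z \<and> z < y" | "x < y \<and> y < z \<and> z < w"
      | "z < w \<and> w < x \<and> x < y" | "z < y \<and> y < x \<and> x < w"
    proof -
      have "w \<noteq> x" "w \<noteq> y" "w \<noteq> z" "x \<noteq> y" "x \<noteq> z" "y \<noteq> z" using d(1) by auto
      then have "x < w \<or> w < x" "x < y \<or> y < x" "z < w \<or> w < z" "z < y \<or> y < z" "w < y \<or> y < w"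
        by auto
      then show ?thesis using that cr unfolding between_def by (elim disjE) simp_all
    qed
    then have "Delta a (insert w (insert x S)) * Delta a (insert y (insert z S))
      < Delta a (insert w (insert y S)) * Delta a (insert x (insert z S))"
    proof cases
      case 1 show ?thesis using T1[of w x y z] 1 by (simp add: insert_commute mult.commute)
    next
      case 2 show ?thesis using T2[of w z y x] 2 by (simp add: insert_commute mult.commute)
    next
      case 3 show ?thesis using T2[of y x w z] 3 by (simp add: insert_commute mult.commute)
    next
      case 4 show ?thesis using T1[of y z w x] 4 by (simp add: insert_commute mult.commute)
    next
      case 5 show ?thesis using T1[of x w z y] 5 by (simp add: insert_commute mult.commute)
    next
      case 6 show ?thesis using T2[of x y z w] 6 by (simp add: insert_commute mult.commute)
    next
      case 7 show ?thesis using T2[of z w x y] 7 by (simp add: insert_commute mult.commute)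
    next
      case 8 show ?thesis using T1[of z y x w] 8 by (simp add: insert_commute mult.commute)
    qed
    then show ?thesis .
  qed
  then show ?thesis using assms unfolding strictly_exchanging_def by blast
qed

text \<open>Contracting a set \<open>C\<close> and renaming the remaining labels preserves the exchange inequalities. This
  is used both to pass from \<open>I, J\<close> to their word and to reverse a word.\<close>

lemma strictly_exchanging_relabel:
  assumes f: "strictly_exchanging f X k"
    and C: "finite C" "C \<subseteq> X" "card C + r = k" "c ` Y \<subseteq> X - C" "inj_on c Y"
    and btw: "\<And>x y z. x \<in> Y \<Longrightarrow> y \<in> Y \<Longrightarrow> z \<in> Y \<Longrightarrow> between (c x) (c y) (c z) = between x y z"
  shows "strictly_exchanging (\<lambda>T. f (C \<union> c ` T)) Y r"
proof -
  have "card (C \<union> c ` T) = card C + card T" if "finite T" "T \<subseteq> Y" for T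
  proof -
    have "card (C \<union> c ` T) = card C + card (c ` T)"
      using that C by (intro card_Un_disjoint) auto
    then show ?thesis using that C(5) by (simp add: card_image inj_on_subset)
  qed
  note cd = this
  have "0 < f (C \<union> c ` T)" if "T \<in> nsets Y r" for T
    using that cd[of T] C by (intro strictly_exchangingD(1)[OF f]) (auto simp: nsets_def)
  moreover have "f (C \<union> c ` insert x (insert y S)) * f (C \<union> c ` insert z (insert u S))
      < f (C \<union> c ` insert x (insert z S)) * f (C \<union> c ` insert y (insert u S))"
    if S: "finite S" "card S + 2 = r" "insert x (insert y (insert z (insert u S))) \<subseteq> Y"
      "distinct [x, y, z, u]" "{x, y, z, u} \<inter> S = {}" "between x z y \<noteq> between x z u" for S x y z u
  proof -
    have inj: "c v = c w \<longleftrightarrow> v = w" if "v \<in> Y" "w \<in> Y" for v w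
      using C(5) that by (auto dest: inj_onD)
    have "f (insert (c x) (insert (c y) (C \<union> c ` S))) * f (insert (c z) (insert (c u) (C \<union> c ` S)))
      < f (insert (c x) (insert (c z) (C \<union> c ` S))) * f (insert (c y) (insert (c u) (C \<union> c ` S)))"
    proof (rule strictly_exchangingD(2)[OF f])
      show "card (C \<union> c ` S) + 2 = k" using S cd[of S] C by simp
      show "distinct [c x, c y, c z, c u]" using S inj by auto
      show "{c x, c y, c z, c u} \<inter> (C \<union> c ` S) = {}"
      proof -
        have "c v \<notin> c ` S" if "v \<in> {x, y, z, u}" for v
        proof
          assume "c v \<in> c ` S"
          then obtain w where w: "w \<in> S" "c v = c w" by blast
          have "v \<in> Y" "w \<in> Y" using that w(1) S(3) by auto
          then have "v = w" using w(2) inj by blast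
          then show False using that w(1) S(5) by auto
        qed
        moreover have "c v \<notin> C" if "v \<in> {x, y, z, u}" for v
          using that C(4) S(3) by auto
        ultimately show ?thesis by auto
      qed
      show "between (c x) (c z) (c y) \<noteq> between (c x) (c z) (c u)" using S btw by auto
    qed (use S C in auto)
    then show ?thesis by simp
  qed
  ultimately show ?thesis unfolding strictly_exchanging_def by blast
qed

text \<open>One step \<open>u \<mapsto> v\<close> is an instance of the elementary inequality; induction moves the remaining pairs
  of \<open>Q\<close>, and the intermediate factors cancel.\<close>

lemma exchange_one_against_many:
  assumes f: "strictly_exchanging f X k"
    and "Q \<noteq> []" "finite S" "card S + length Q + 1 = k"
    and "insert x (insert y (S \<union> set (map fst Q) \<union> set (map snd Q))) \<subseteq> X"
    and "distinct (x # y # map fst Q @ map snd Q)"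
    and "S \<inter> (insert x (insert y (set (map fst Q) \<union> set (map snd Q)))) = {}"
    and "\<And>u v. (u, v) \<in> set Q \<Longrightarrow> between x u y \<noteq> between x u v"
  shows "f (insert x (S \<union> set (map snd Q))) * f (insert y (S \<union> set (map fst Q)))
    < f (insert x (S \<union> set (map fst Q))) * f (insert y (S \<union> set (map snd Q)))"
  using assms(2-)
proof (induction Q arbitrary: S)
  case Nil then show ?case by simp
next
  case (Cons q Q)
  obtain u v where q: "q = (u, v)" by (cases q)
  let ?A = "set (map fst Q)" and ?B = "set (map snd Q)"
  have cA: "card ?A = length Q" using Cons.prems(5) by (metis distinct_append distinct_card distinct.simps(2) length_map list.simps(9))
  have cB: "card ?B = length Q" using Cons.prems(5) by (metis distinct_append distinct_card distinct.simps(2) length_map list.simps(9))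
  have sq: "f (insert x (insert v (S \<union> ?A))) * f (insert u (insert y (S \<union> ?A)))
      < f (insert x (insert u (S \<union> ?A))) * f (insert v (insert y (S \<union> ?A)))"
  proof (rule strictly_exchangingD(2)[OF f])
    show "card (S \<union> ?A) + 2 = k"
      using Cons.prems cA by (subst card_Un_disjoint) (auto simp: q)
    show "between x u v \<noteq> between x u y" using Cons.prems(7)[of u v] by (auto simp: q)
  qed (use Cons.prems in \<open>auto simp: q\<close>)
  show ?case
  proof (cases "Q = []")
    case True
    then show ?thesis using sq by (simp add: q insert_commute)
  next
    case False
    have IH: "f (insert x (insert v S \<union> ?B)) * f (insert y (insert v S \<union> ?A))
      < f (insert x (insert v S \<union> ?A)) * f (insert y (insert v S \<union> ?B))"
      by (rule Cons.IH) (use False Cons.prems in \<open>auto simp: q\<close>)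
    have pos: "0 < f (insert z (insert w (S \<union> ?A)))"
      if "z \<in> {x, y}" "w \<in> {u, v}" for z w
    proof (rule strictly_exchangingD(1)[OF f])
      have "card (insert z (insert w (S \<union> ?A))) = Suc (Suc (card (S \<union> ?A)))"
        using that Cons.prems by (auto simp: q)
      also have "card (S \<union> ?A) = card S + length Q"
        using Cons.prems cA by (subst card_Un_disjoint) (auto simp: q)
      finally show "insert z (insert w (S \<union> ?A)) \<in> nsets X k"
        using that Cons.prems by (auto simp: q nsets_def)
    qed
    have pos': "0 < f (insert z (insert v (S \<union> ?B)))" if "z \<in> {x, y}" for z
    proof (rule strictly_exchangingD(1)[OF f])
      have "card (insert z (insert v (S \<union> ?B))) = Suc (Suc (card (S \<union> ?B)))"
        using that Cons.prems by (auto simp: q)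
      also have "card (S \<union> ?B) = card S + length Q"
        using Cons.prems cB by (subst card_Un_disjoint) (auto simp: q)
      finally show "insert z (insert v (S \<union> ?B)) \<in> nsets X k"
        using that Cons.prems by (auto simp: q nsets_def)
    qed
    define p where "p z w = f (insert z (insert w (S \<union> ?A)))" for z w
    define p' where "p' z = f (insert z (insert v (S \<union> ?B)))" for z
    have 1: "p x v * p y u < p x u * p y v" using sq by (simp add: p_def insert_commute)
    have 2: "p' x * p y v < p x v * p' y" using IH by (simp add: p_def p'_def)
    have P: "0 < p x u" "0 < p x v" "0 < p y u" "0 < p y v" "0 < p' x" "0 < p' y"
      using pos pos' by (simp_all add: p_def p'_def)
    have "(p x v * p y u) * (p' x * p y v) < (p x u * p y v) * (p x v * p' y)"
      by (rule mult_strict_mono[OF 1 2]) (use P in \<open>auto intro: mult_pos_pos less_imp_le\<close>)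
    then have "(p x v * p y v) * (p' x * p y u) < (p x v * p y v) * (p x u * p' y)"
      by (simp add: mult_ac)
    then have "p' x * p y u < p x u * p' y" using P by (simp add: mult_less_cancel_left_pos)
    then show ?thesis by (simp add: q p_def p'_def)
  qed
qed

text \<open>The products on the two sides are the corners of a grid whose two directions move the pairs of
  \<open>P\<close> and of \<open>Q\<close>; the inequality is the product of the elementary ones over its cells.\<close>

lemma exchange_pairs_inequality:
  assumes f: "strictly_exchanging f X k"
    and "P \<noteq> []" "Q \<noteq> []" "finite S" "card S + length P + length Q = k"
    and "S \<union> set (map fst P) \<union> set (map snd P) \<union> set (map fst Q) \<union> set (map snd Q) \<subseteq> X"
    and "distinct (map fst P @ map snd P @ map fst Q @ map snd Q)"
    and "S \<inter> (set (map fst P) \<union> set (map snd P) \<union> set (map fst Q) \<union> set (map snd Q)) = {}"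
    and "\<And>x y u v. (x, y) \<in> set P \<Longrightarrow> (u, v) \<in> set Q \<Longrightarrow> between x u y \<noteq> between x u v"
  shows "f (S \<union> set (map fst P) \<union> set (map snd Q)) * f (S \<union> set (map snd P) \<union> set (map fst Q))
    < f (S \<union> set (map fst P) \<union> set (map fst Q)) * f (S \<union> set (map snd P) \<union> set (map snd Q))"
  using assms(2-)
proof (induction P arbitrary: S)
  case Nil then show ?case by simp
next
  case (Cons p P)
  obtain x y where p: "p = (x, y)" by (cases p)
  let ?A = "set (map fst P)" and ?B = "set (map snd P)" and ?C = "set (map fst Q)" and ?D = "set (map snd Q)"
  have dA: "distinct (map fst P)" and dB: "distinct (map snd P)"
    and dC: "distinct (map fst Q)" and dD: "distinct (map snd Q)"
    using Cons.prems(6) by simp_all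
  have cd: "card ?A = length P" "card ?B = length P" "card ?C = length Q" "card ?D = length Q"
    using dA dB dC dD by (metis distinct_card length_map)+
  have one: "f (insert x (S \<union> ?A \<union> ?D)) * f (insert y (S \<union> ?A \<union> ?C))
      < f (insert x (S \<union> ?A \<union> ?C)) * f (insert y (S \<union> ?A \<union> ?D))"
  proof (rule exchange_one_against_many[OF f Cons.prems(2)])
    show "card (S \<union> ?A) + length Q + 1 = k"
      using Cons.prems cd by (subst card_Un_disjoint) (auto simp: p)
    show "between x u y \<noteq> between x u v" if "(u, v) \<in> set Q" for u v
      using Cons.prems(8)[of x y u v] that by (simp add: p)
    show "finite (S \<union> ?A)" using Cons.prems by simp
    show "insert x (insert y (S \<union> ?A \<union> ?C \<union> ?D)) \<subseteq> X" using Cons.prems(5) by (auto simp: p)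
    show "distinct (x # y # map fst Q @ map snd Q)" using Cons.prems(6) by (auto simp: p)
    show "(S \<union> ?A) \<inter> insert x (insert y (?C \<union> ?D)) = {}"
      using Cons.prems(6,7) by (auto simp: p)
  qed
  show ?case
  proof (cases "P = []")
    case True
    then show ?thesis using one by (simp add: p)
  next
    case False
    have IH: "f (insert y S \<union> ?A \<union> ?D) * f (insert y S \<union> ?B \<union> ?C)
      < f (insert y S \<union> ?A \<union> ?C) * f (insert y S \<union> ?B \<union> ?D)"
    proof (rule Cons.IH[OF False Cons.prems(2)])
      show "finite (insert y S)" using Cons.prems by simp
      show "card (insert y S) + length P + length Q = k" using Cons.prems by (auto simp: p)
      show "insert y S \<union> ?A \<union> ?B \<union> ?C \<union> ?D \<subseteq> X" using Cons.prems(5) by (auto simp: p)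
      show "distinct (map fst P @ map snd P @ map fst Q @ map snd Q)" using Cons.prems(6) by (auto simp: p)
      show "insert y S \<inter> (?A \<union> ?B \<union> ?C \<union> ?D) = {}" using Cons.prems(6,7) by (auto simp: p)
      show "between x' u y' \<noteq> between x' u v" if "(x', y') \<in> set P" "(u, v) \<in> set Q" for x' y' u v
        using Cons.prems(8)[of x' y' u v] that by simp
    qed
    have pos: "0 < f (insert z (S \<union> M \<union> N))" if "z \<in> {x, y}" "M \<in> {?A, ?B}" "N \<in> {?C, ?D}" for z M N
    proof (rule strictly_exchangingD(1)[OF f])
      have fin: "finite M" "finite N" and MN: "card M = length P" "card N = length Q"
        using that(2,3) cd by auto
      have "S \<inter> M = {}" "S \<inter> N = {}" "M \<inter> N = {}"
        using that(2,3) Cons.prems(6,7) by (auto simp: p)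
      moreover have "z \<notin> S" "z \<notin> M" "z \<notin> N"
        using that Cons.prems(6,7) by (auto simp: p)
      ultimately have dj: "S \<inter> M = {}" "(S \<union> M) \<inter> N = {}" "z \<notin> S \<union> M \<union> N" by auto
      have "card (insert z (S \<union> M \<union> N)) = Suc (card (S \<union> M \<union> N))"
        using dj fin Cons.prems(3) by simp
      also have "card (S \<union> M \<union> N) = card (S \<union> M) + card N"
        using dj fin Cons.prems(3) by (intro card_Un_disjoint) auto
      also have "card (S \<union> M) = card S + card M"
        using dj fin Cons.prems(3) by (intro card_Un_disjoint) auto
      finally have "card (insert z (S \<union> M \<union> N)) = Suc (card S + card M + card N)" .
      then show "insert z (S \<union> M \<union> N) \<in> nsets X k"
        using that Cons.prems(3-5) MN fin by (auto simp: p nsets_def)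
    qed
    define g where "g z M N = f (insert z (S \<union> M \<union> N))" for z M N
    have 1: "g x ?A ?D * g y ?A ?C < g x ?A ?C * g y ?A ?D" using one by (simp add: g_def)
    have 2: "g y ?A ?D * g y ?B ?C < g y ?A ?C * g y ?B ?D" using IH by (simp add: g_def)
    have G: "0 < g z M N" if "z \<in> {x, y}" "M \<in> {?A, ?B}" "N \<in> {?C, ?D}" for z M N
      using pos[OF that] by (simp add: g_def)
    have "(g x ?A ?D * g y ?A ?C) * (g y ?A ?D * g y ?B ?C) < (g x ?A ?C * g y ?A ?D) * (g y ?A ?C * g y ?B ?D)"
      by (rule mult_strict_mono[OF 1 2]) (use G in \<open>auto intro: mult_pos_pos less_imp_le\<close>)
    then have "(g y ?A ?C * g y ?A ?D) * (g x ?A ?D * g y ?B ?C)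
      < (g y ?A ?C * g y ?A ?D) * (g x ?A ?C * g y ?B ?D)" by (simp add: mult_ac)
    moreover have "0 < g y ?A ?C * g y ?A ?D" using G by (intro mult_pos_pos) auto
    ultimately have "g x ?A ?D * g y ?B ?C < g x ?A ?C * g y ?B ?D"
      by (simp add: mult_less_cancel_left_pos)
    then show ?thesis by (simp add: p g_def)
  qed
qed

text \<open>The inequality for the word \<open>UUDUDUUDDD\<close>. On taking logarithms, fourteen elementary inequalities
  add up to it: each auxiliary minor occurs once on a smaller and once on a larger side. Seven of
  them were found by linear programming, the others are their images under complementation
  followed by the reflection of the cyclic order that fixes \<open>{0, 1, 3, 5, 6}\<close>.\<close>

lemma exceptional_exchange:
  assumes f: "strictly_exchanging f {..<10} 5"
  shows "f {0,1,2,3,4} * f {5,6,7,8,9} * (f {2,3,4,5,6} * f {0,1,7,8,9})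
    < (f {0,1,3,5,6} * f {2,4,7,8,9})\<^sup>2"
proof -
  define h where "h xs = ln (f (set xs))" for xs
  have pos: "0 < f (set xs)" if "distinct xs" "length xs = 5" "list_all (\<lambda>x. x < 10) xs" for xs
    using that by (intro strictly_exchangingD(1)[OF f]) (auto simp: nsets_def distinct_card list_all_iff)
  have ex: "h as + h bs < h cs + h ds"
    if "finite S" "card S + 2 = 5" "insert a (insert b (insert c (insert d S))) \<subseteq> {..<10}"
      "distinct [a, b, c, d]" "{a, b, c, d} \<inter> S = {}" "between a c b \<noteq> between a c d"
      and s: "set as = insert a (insert b S)" "set bs = insert c (insert d S)"
      "set cs = insert a (insert c S)" "set ds = insert b (insert d S)" for a b c d S as bs cs ds
  proof -
    have "0 < f (set xs)" if "xs \<in> {as, bs, cs, ds}" for xs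
      using that \<open>finite S\<close> \<open>card S + 2 = 5\<close> \<open>insert a _ \<subseteq> _\<close> \<open>distinct [a, b, c, d]\<close> \<open>{a, b, c, d} \<inter> S = {}\<close> s
      by (intro strictly_exchangingD(1)[OF f]) (auto simp: nsets_def)
    moreover have "f (set as) * f (set bs) < f (set cs) * f (set ds)"
      unfolding s by (rule strictly_exchangingD(2)[OF f]) (use that in auto)
    ultimately have "ln (f (set as) * f (set bs)) < ln (f (set cs) * f (set ds))"
      by (simp add: ln_less_cancel_iff mult_pos_pos)
    then show ?thesis
      using \<open>\<And>xs. xs \<in> {as, bs, cs, ds} \<Longrightarrow> 0 < f (set xs)\<close> by (simp add: h_def ln_mult_pos)
  qed
  have
    "h [0,2,3,5,7] + h [0,2,4,5,6] < h [0,2,3,5,6] + h [0,2,4,5,7]"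
    "h [3,5,7,8,9] + h [0,2,5,7,8] < h [0,3,5,7,8] + h [2,5,7,8,9]"
    "h [0,1,2,3,5] + h [0,3,5,6,7] < h [0,1,3,5,6] + h [0,2,3,5,7]"
    "h [2,4,5,7,8] + h [0,2,7,8,9] < h [0,2,5,7,8] + h [2,4,7,8,9]"
    "h [0,1,2,3,4] + h [0,1,2,5,9] < h [0,1,2,3,5] + h [0,1,2,4,9]"
    "h [0,2,3,8,9] + h [0,1,7,8,9] < h [0,1,3,8,9] + h [0,2,7,8,9]"
    "h [0,1,3,8,9] + h [0,2,3,6,9] < h [0,1,3,6,9] + h [0,2,3,8,9]"
    "h [1,2,5,8,9] + h [0,1,2,4,9] < h [0,1,2,5,9] + h [1,2,4,8,9]"
    "h [0,1,3,6,9] + h [0,2,3,5,6] < h [0,1,3,5,6] + h [0,2,3,6,9]"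
    "h [2,5,7,8,9] + h [1,2,4,8,9] < h [1,2,5,8,9] + h [2,4,7,8,9]"
    "h [2,3,4,5,6] + h [0,2,4,5,7] < h [0,2,4,5,6] + h [2,3,4,5,7]"
    "h [0,3,5,7,8] + h [5,6,7,8,9] < h [0,5,6,7,8] + h [3,5,7,8,9]"
    "h [2,3,5,6,7] + h [0,5,6,7,8] < h [0,3,5,6,7] + h [2,5,6,7,8]"
    "h [2,3,4,5,7] + h [2,5,6,7,8] < h [2,3,5,6,7] + h [2,4,5,7,8]"
    subgoal by (rule ex[of "{0,2,5}" 3 7 6 4]) (auto simp: between_def)
    subgoal by (rule ex[of "{5,7,8}" 3 9 0 2]) (auto simp: between_def)
    subgoal by (rule ex[of "{0,3,5}" 1 2 6 7]) (auto simp: between_def)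
    subgoal by (rule ex[of "{2,7,8}" 5 4 0 9]) (auto simp: between_def)
    subgoal by (rule ex[of "{0,1,2}" 3 4 5 9]) (auto simp: between_def)
    subgoal by (rule ex[of "{0,8,9}" 3 2 1 7]) (auto simp: between_def)
    subgoal by (rule ex[of "{0,3,9}" 1 8 6 2]) (auto simp: between_def)
    subgoal by (rule ex[of "{1,2,9}" 5 8 0 4]) (auto simp: between_def)
    subgoal by (rule ex[of "{0,3,6}" 1 9 5 2]) (auto simp: between_def)
    subgoal by (rule ex[of "{2,8,9}" 5 7 1 4]) (auto simp: between_def)
    subgoal by (rule ex[of "{2,4,5}" 6 3 0 7]) (auto simp: between_def)
    subgoal by (rule ex[of "{5,7,8}" 0 3 6 9]) (auto simp: between_def)
    subgoal by (rule ex[of "{5,6,7}" 3 2 0 8]) (auto simp: between_def)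
    subgoal by (rule ex[of "{2,5,7}" 3 4 6 8]) (auto simp: between_def)
    done
  then have "h [0,1,2,3,4] + h [5,6,7,8,9] + (h [2,3,4,5,6] + h [0,1,7,8,9])
      < 2 * (h [0,1,3,5,6] + h [2,4,7,8,9])"
    by (smt (verit))
  then have "ln (f {0,1,2,3,4} * f {5,6,7,8,9} * (f {2,3,4,5,6} * f {0,1,7,8,9}))
      < ln ((f {0,1,3,5,6} * f {2,4,7,8,9})\<^sup>2)"
    using pos[of "[0,1,2,3,4]"] pos[of "[5,6,7,8,9]"] pos[of "[2,3,4,5,6]"] pos[of "[0,1,7,8,9]"]
      pos[of "[0,1,3,5,6]"] pos[of "[2,4,7,8,9]"]
    by (simp add: h_def ln_mult_pos ln_realpow)
  then show ?thesis
    using pos[of "[0,1,2,3,4]"] pos[of "[5,6,7,8,9]"] pos[of "[2,3,4,5,6]"] pos[of "[0,1,7,8,9]"]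
      pos[of "[0,1,3,5,6]"] pos[of "[2,4,7,8,9]"]
    by (subst (asm) ln_less_cancel_iff) simp_all
qed

section \<open>Matrices realizing a word\<close>

text \<open>All maximal minors of an integer matrix are computed at once, as the coefficients of the
  exterior product of its rows. A form on \<open>n\<close> letters is a binary tree of depth \<open>n\<close>: \<open>Split S T\<close>
  collects in \<open>T\<close> the monomials that contain the first letter, and in \<open>S\<close> the others. Sharing the minors
  of the lower rows in this way keeps the evaluation inside the simplifier short.\<close>

datatype form = Zero | Coeff int | Split form form

fun coef :: "form \<Rightarrow> bool list \<Rightarrow> int" where
  "coef Zero bs = 0"
| "coef (Coeff x) bs = x"
| "coef (Split S T) [] = 0"
| "coef (Split S T) (b # bs) = coef (if b then T else S) bs"

fun fits :: "nat \<Rightarrow> form \<Rightarrow> bool" where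
  "fits n Zero = True"
| "fits n (Coeff x) = (n = 0)"
| "fits 0 (Split S T) = False"
| "fits (Suc n) (Split S T) = (fits n S \<and> fits n T)"

fun plus_form :: "form \<Rightarrow> form \<Rightarrow> form" where
  "plus_form Zero T = T"
| "plus_form T Zero = T"
| "plus_form (Coeff x) (Coeff y) = Coeff (x + y)"
| "plus_form (Split S S') (Split T T') = Split (plus_form S T) (plus_form S' T')"
| "plus_form _ _ = Zero"

fun scale_form :: "int \<Rightarrow> form \<Rightarrow> form" where
  "scale_form c Zero = Zero"
| "scale_form c (Coeff x) = Coeff (c * x)"
| "scale_form c (Split S T) = (if c = 0 then Zero else Split (scale_form c S) (scale_form c T))"

text \<open>The product of a linear form with \<open>T\<close>, up to the sign \<open>s\<close>. The sign flips below a letter that is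
  present, because the linear form has to pass it.\<close>

fun wedge :: "bool \<Rightarrow> int list \<Rightarrow> form \<Rightarrow> form" where
  "wedge s [] T = Zero"
| "wedge s (x # xs) (Split S T) = Split (wedge s xs S)
     (plus_form (scale_form (if s then x else - x) S) (wedge (\<not> s) xs T))"
| "wedge s (x # xs) _ = Zero"

fun unit_form :: "nat \<Rightarrow> form" where
  "unit_form 0 = Coeff 1"
| "unit_form (Suc n) = Split (unit_form n) Zero"

definition rows_form :: "nat \<Rightarrow> int list list \<Rightarrow> form" where
  "rows_form n rs = foldr (wedge True) rs (unit_form n)"

lemma fits_plus_form:
  "fits n S \<Longrightarrow> fits n T \<Longrightarrow> fits n (plus_form S T)"
proof (induction S T arbitrary: n rule: plus_form.induct)
  case (4 S S' T T') then show ?case by (cases n) auto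
qed auto

lemma coef_plus_form:
  "fits n S \<Longrightarrow> fits n T \<Longrightarrow> length bs = n \<Longrightarrow> coef (plus_form S T) bs = coef S bs + coef T bs"
proof (induction S T arbitrary: n bs rule: plus_form.induct)
  case (4 S S' T T')
  then show ?case by (cases n; cases bs) auto
qed (auto split: nat.splits elim: fits.elims)

lemma fits_scale_form: "fits n T \<Longrightarrow> fits n (scale_form c T)"
  by (induction n T rule: fits.induct) auto

lemma coef_scale_form: "coef (scale_form c T) bs = c * coef T bs"
  by (induction T bs rule: coef.induct) auto

lemma fits_wedge: "fits (length xs) T \<Longrightarrow> fits (length xs) (wedge s xs T)"
  by (induction s xs T rule: wedge.induct) (auto intro!: fits_plus_form fits_scale_form)

lemma fits_unit_form: "fits n (unit_form n)"
  by (induction n) auto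

lemma fits_rows_form:
  assumes "\<forall>\<rho> \<in> set rs. length \<rho> = n"
  shows "fits n (rows_form n rs)"
  using assms by (induction rs) (auto simp: rows_form_def fits_unit_form intro: fits_wedge)

definition trues :: "bool list \<Rightarrow> nat set" where
  "trues bs = {j. j < length bs \<and> bs ! j}"

lemma finite_trues [simp]: "finite (trues bs)"
  by (simp add: trues_def)

lemma trues_Cons: "trues (b # bs) = (if b then {0} else {}) \<union> Suc ` trues bs"
  by (auto simp: trues_def nth_Cons image_iff split: nat.splits if_splits)
     (metis Suc_less_eq Suc_pred neq0_conv nth_Cons_Suc diff_Suc_1 not0_implies_Suc)+

lemma trues_Nil [simp]: "trues [] = {}"
  by (simp add: trues_def)

lemma card_trues_Cons: "card (trues (b # bs)) = (if b then 1 else 0) + card (trues bs)"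
  by (simp add: trues_Cons card_image card_Un_disjoint)

lemma coef_wedge:
  assumes "length xs = n" "fits n T" "length bs = n"
  shows "coef (wedge s xs T) bs = (if s then 1 else - 1) *
    (\<Sum>j\<in>trues bs. (- 1) ^ card {i \<in> trues bs. i < j} * xs ! j * coef T (bs[j := False]))"
  using assms
proof (induction s xs T arbitrary: n bs rule: wedge.induct)
  case (2 s x xs S T)
  obtain m where n: "n = Suc m" using 2 by (cases n) auto
  obtain b bs' where bs: "bs = b # bs'" using 2 n by (cases bs) auto
  have len: "length xs = m" "length bs' = m" and fit: "fits m S" "fits m T" using 2 n bs by auto
  have shift: "{i \<in> trues bs. i < Suc j} = (if b then {0} else {}) \<union> Suc ` {i \<in> trues bs'. i < j}" for j
    unfolding bs trues_Cons by auto
  have sg: "(- 1 :: int) ^ card {i \<in> trues bs. i < Suc j}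
      = (if b then - 1 else 1) * (- 1) ^ card {i \<in> trues bs'. i < j}" for j
    unfolding shift by (simp add: card_image card_Un_disjoint)
  have z: "{i \<in> trues bs. i < 0} = {}" by simp
  let ?g = "\<lambda>j. (- 1) ^ card {i \<in> trues bs. i < j} * (x # xs) ! j * coef (Split S T) (bs[j := False])"
  have "sum ?g (trues bs) = (if b then ?g 0 else 0) + (\<Sum>j\<in>trues bs'. ?g (Suc j))"
    unfolding bs trues_Cons by (subst sum.union_disjoint) (auto simp: sum.reindex)
  also have "(\<Sum>j\<in>trues bs'. ?g (Suc j)) = (if b then - 1 else 1) * (\<Sum>j\<in>trues bs'.
      (- 1) ^ card {i \<in> trues bs'. i < j} * xs ! j * coef (if b then T else S) (bs'[j := False]))"
    unfolding sg by (simp add: bs sum_distrib_left mult_ac)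
  finally have G: "sum ?g (trues bs) = (if b then x * coef S bs' else 0) + (if b then - 1 else 1) *
      (\<Sum>j\<in>trues bs'. (- 1) ^ card {i \<in> trues bs'. i < j} * xs ! j * coef (if b then T else S) (bs'[j := False]))"
    by (simp add: bs z)
  have fw: "fits m (scale_form (if s then x else - x) S)" "fits m (wedge (\<not> s) xs T)"
    using fits_scale_form fits_wedge fit len by auto
  show ?case
  proof (cases b)
    case True
    then show ?thesis unfolding G
      using "2.IH"(2)[OF len(1) fit(2) len(2)] coef_plus_form[OF fw len(2)]
      by (simp add: bs coef_scale_form)
  next
    case False
    then show ?thesis unfolding G using "2.IH"(1)[OF len(1) fit(1) len(2)] by (simp add: bs)
  qed
qed auto

lemma Delta_expand_first_row:
  assumes "finite Y" "Y \<noteq> {}"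
  shows "Delta a Y = (\<Sum>y\<in>Y. (- 1) ^ card {x \<in> Y. x < y} * a 0 y * Delta (\<lambda>i. a (Suc i)) (Y - {y}))"
  using Delta_expand_row[of Y 0 a] assms by (simp add: card_gt_0_iff skip_row_def[abs_def])

lemma trues_update: "trues (bs[j := False]) = trues bs - {j}"
  by (cases "j < length bs") (auto simp: trues_def nth_list_update split: if_splits)

lemma coef_unit_form: "trues bs = {} \<Longrightarrow> length bs = n \<Longrightarrow> coef (unit_form n) bs = 1"
proof (induction n arbitrary: bs)
  case (Suc n)
  then show ?case by (cases bs) (auto simp: trues_Cons split: if_splits)
qed simp

lemma coef_rows_form:
  assumes "\<forall>\<rho> \<in> set rs. length \<rho> = n" "length bs = n" "card (trues bs) = length rs"
  shows "real_of_int (coef (rows_form n rs) bs) = Delta (\<lambda>i j. real_of_int (rs ! i ! j)) (trues bs)"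
  using assms
proof (induction rs arbitrary: bs)
  case Nil
  then show ?case by (simp add: rows_form_def coef_unit_form)
next
  case (Cons \<rho> rs)
  let ?a = "\<lambda>i j. real_of_int ((\<rho> # rs) ! i ! j)"
  have ne: "trues bs \<noteq> {}" using Cons.prems(3) by auto
  have IH: "real_of_int (coef (rows_form n rs) (bs[j := False]))
      = Delta (\<lambda>i. ?a (Suc i)) (trues bs - {j})" if "j \<in> trues bs" for j
    using Cons.IH[of "bs[j := False]"] Cons.prems that by (simp add: trues_update)
  have "coef (rows_form n (\<rho> # rs)) bs =
    (\<Sum>j\<in>trues bs. (- 1) ^ card {i \<in> trues bs. i < j} * \<rho> ! j * coef (rows_form n rs) (bs[j := False]))"
    using coef_wedge[of \<rho> n "rows_form n rs" bs True] fits_rows_form[of rs n] Cons.prems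
    by (simp add: rows_form_def)
  then have "real_of_int (coef (rows_form n (\<rho> # rs)) bs) = (\<Sum>j\<in>trues bs.
      (- 1) ^ card {i \<in> trues bs. i < j} * ?a 0 j * real_of_int (coef (rows_form n rs) (bs[j := False])))"
    by simp
  also have "\<dots> = Delta ?a (trues bs)"
    unfolding Delta_expand_first_row[OF finite_trues ne]
    by (rule sum.cong[OF refl]) (simp only: IH)
  finally show ?case .
qed

text \<open>The monomials of degree \<open>d\<close> have coefficients at least \<open>m\<close> if they contain the letter \<open>c\<close>, and at
  least \<open>l\<close> otherwise. Once the letter \<open>c\<close> has been passed, both bounds agree. An absent subtree
  stands for zero coefficients and is accepted only where no monomial of degree \<open>d\<close> exists.\<close>

primrec coeffs_ge :: "nat \<Rightarrow> nat \<Rightarrow> nat \<Rightarrow> int \<Rightarrow> int \<Rightarrow> form \<Rightarrow> bool" where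
  "coeffs_ge 0 d c l m T = (d = 0 \<longrightarrow> (case T of Coeff x \<Rightarrow> l \<le> x | _ \<Rightarrow> False))"
| "coeffs_ge (Suc n) d c l m T = (d \<le> Suc n \<longrightarrow> (case T of Split S T' \<Rightarrow>
     coeffs_ge n d (c - 1) l (if c = 0 then l else m) S \<and>
     (d > 0 \<longrightarrow> coeffs_ge n (d - 1) (c - 1) (if c = 0 then m else l) m T') | _ \<Rightarrow> False))"

lemma card_trues_le: "card (trues bs) \<le> length bs"
  by (induction bs) (auto simp: card_trues_Cons)

lemma coeffs_geD:
  assumes "coeffs_ge n d c l m T" "length bs = n" "card (trues bs) = d"
  shows "(if c < n \<and> bs ! c then m else l) \<le> coef T bs"
  using assms
proof (induction n arbitrary: d c l m T bs)
  case 0 then show ?case by (auto split: form.splits)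
next
  case (Suc n)
  obtain b bs' where bs: "bs = b # bs'" "length bs' = n" using Suc.prems(2) by (cases bs) auto
  have "d \<le> Suc n" using Suc.prems card_trues_le by metis
  then obtain S T' where T: "T = Split S T'" using Suc.prems(1) by (auto split: form.splits)
  show ?case
  proof (cases b)
    case True
    then have d: "0 < d" "card (trues bs') = d - 1" using Suc.prems(3) bs by (auto simp: card_trues_Cons)
    then have "coeffs_ge n (d - 1) (c - 1) (if c = 0 then m else l) m T'"
      using Suc.prems(1) \<open>d \<le> Suc n\<close> T by simp
    from Suc.IH[OF this bs(2) d(2)] show ?thesis using True bs T by (cases c) (auto split: if_splits)
  next
    case False
    then have d: "card (trues bs') = d" using Suc.prems(3) bs by (auto simp: card_trues_Cons)
    have "coeffs_ge n d (c - 1) l (if c = 0 then l else m) S"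
      using Suc.prems(1) \<open>d \<le> Suc n\<close> T by simp
    from Suc.IH[OF this bs(2) d] show ?thesis using False bs T by (cases c) (auto split: if_splits)
  qed
qed

text \<open>The two distinguished minors \<open>m\<close> and \<open>l\<close> may differ: it suffices that \<open>m\<close> is minimal among the minors
  with column \<open>c\<close> and \<open>l\<close> among those without, as column \<open>c\<close> can be multiplied by \<open>l / m\<close>.\<close>

definition realized_by :: "bool list \<Rightarrow> nat \<Rightarrow> int list list \<Rightarrow> bool" where
  "realized_by w c rs \<longleftrightarrow> (let n = length w; T = rows_form n rs;
       l = coef T (map Not w); m = coef T w in
     0 < l \<and> 0 < m \<and> c < n \<and> w ! c \<and> list_all (\<lambda>\<rho>. length \<rho> = n) rs \<and>
     length (filter id w) = length rs \<and> n = 2 * length rs \<and>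
     coeffs_ge n (length rs) c l m T)"

lemma card_trues_filter: "card (trues w) = length (filter id w)"
  by (induction w) (auto simp: card_trues_Cons)

lemma realized_by_jointly_smallest:
  assumes "realized_by w c rs"
  shows "jointly_smallest (length rs) {..<length w} (trues w) (trues (map Not w))"
proof -
  let ?n = "length w" and ?k = "length rs"
  define T where "T = rows_form ?n rs"
  define l where "l = coef T (map Not w)"
  define m where "m = coef T w"
  have R: "0 < l" "0 < m" "c < ?n" "w ! c" "\<forall>\<rho> \<in> set rs. length \<rho> = ?n"
    "card (trues w) = ?k" "?n = 2 * ?k" "coeffs_ge ?n ?k c l m T"
    using assms unfolding realized_by_def Let_def l_def m_def T_def card_trues_filter list_all_iff
    by blast+
  define a where "a i j = real_of_int (rs ! i ! j)" for i j
  define s where "s j = (if j = c then real_of_int l / real_of_int m else 1)" for j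
  define b where "b i j = s j * a i j" for i j
  have minors: "(if c \<in> K then m else l) \<le> coef T (map (\<lambda>j. j \<in> K) [0..<?n])"
    "Delta a K = coef T (map (\<lambda>j. j \<in> K) [0..<?n])" if "K \<in> nsets {..<?n} ?k" for K
  proof -
    let ?bs = "map (\<lambda>j. j \<in> K) [0..<?n]"
    have t: "trues ?bs = K" using that by (auto simp: trues_def nsets_def)
    then have cd: "card (trues ?bs) = ?k" using that by (simp add: nsets_def)
    show "(if c \<in> K then m else l) \<le> coef T ?bs"
      using coeffs_geD[OF R(8) _ cd] R(3) by simp
    show "Delta a K = coef T ?bs"
      using coef_rows_form[OF R(5) _ cd] unfolding t by (simp add: a_def[abs_def] T_def)
  qed
  have scaled: "Delta b K = (if c \<in> K then real_of_int l / real_of_int m else 1) * Delta a K"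
    if "finite K" for K
    unfolding b_def Delta_scale_columns[OF that] s_def using that by (simp add: prod.delta)
  have ge: "real_of_int l \<le> Delta b K" if K: "K \<in> nsets {..<?n} ?k" for K
  proof -
    have "finite K" using K by (simp add: nsets_def)
    moreover have "real_of_int (if c \<in> K then m else l) \<le> Delta a K"
      unfolding minors(2)[OF K] of_int_le_iff by (rule minors(1)[OF K])
    ultimately show ?thesis using R(1,2) by (auto simp: scaled field_simps)
  qed
  have card_false: "card (trues (map Not w)) = ?k"
  proof -
    have "trues (map Not w) = {..<?n} - trues w" by (auto simp: trues_def)
    moreover have "trues w \<subseteq> {..<?n}" by (auto simp: trues_def)
    ultimately show ?thesis using R(6,7) by (simp add: card_Diff_subset)
  qed
  have I: "trues w \<in> nsets {..<?n} ?k" "trues (map Not w) \<in> nsets {..<?n} ?k"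
    using R(6) card_false by (auto simp: nsets_def trues_def)
  have "map (\<lambda>j. j \<in> trues w) [0..<?n] = w" "map (\<lambda>j. j \<in> trues (map Not w)) [0..<?n] = map Not w"
    by (rule nth_equalityI; simp add: trues_def)+
  then have "Delta a (trues w) = m" "Delta a (trues (map Not w)) = l"
    using minors(2)[OF I(1)] minors(2)[OF I(2)] by (simp_all add: m_def l_def)
  moreover have "c \<in> trues w" "c \<notin> trues (map Not w)" using R(3,4) by (auto simp: trues_def)
  ultimately have "Delta b (trues w) = l" "Delta b (trues (map Not w)) = l"
    using R(1,2) by (simp_all add: scaled)
  moreover have "0 < Delta b K" if "K \<in> nsets {..<?n} ?k" for K
    using ge[OF that] R(1) by simp
  ultimately show ?thesis unfolding jointly_smallest_def
    using ge by (intro exI[of _ b]) simp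
qed

lemma sorted_list_of_set_image_strict_mono:
  fixes c :: "nat \<Rightarrow> nat"
  assumes "finite K" "strict_mono_on K c"
  shows "sorted_list_of_set (c ` K) = map c (sorted_list_of_set K)"
proof -
  have "strict_sorted (map c (sorted_list_of_set K))"
    unfolding sorted_wrt_map
    by (rule sorted_wrt_mono_rel[OF _ strict_sorted_list_of_set])
       (use assms in \<open>auto dest: strict_mono_onD\<close>)
  moreover have "set (map c (sorted_list_of_set K)) = c ` K" using assms by simp
  ultimately show ?thesis
    by (metis sorted_list_of_set.idem_if_sorted_distinct strict_sorted_iff)
qed

lemma jointly_smallest_relabel:
  assumes js: "jointly_smallest k Y A B" and Y: "finite Y" "strict_mono_on Y c"
    and AB: "A \<in> nsets Y k" "B \<in> nsets Y k"
  shows "jointly_smallest k (c ` Y) (c ` A) (c ` B)"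
proof -
  obtain a where a: "\<And>K. K \<in> nsets Y k \<Longrightarrow> 0 < Delta a K" "Delta a A = Delta a B"
    "\<And>K. K \<in> nsets Y k \<Longrightarrow> Delta a A \<le> Delta a K"
    using js unfolding jointly_smallest_def by blast
  have inj: "inj_on c Y" using Y(2) by (rule strict_mono_on_imp_inj_on)
  define b where "b i x = a i (inv_into Y c x)" for i x
  have same: "Delta b (c ` K) = Delta a K" if "K \<subseteq> Y" for K
  proof -
    have fK: "finite K" using that Y(1) finite_subset by auto
    have "strict_mono_on K c" using Y(2) that by (auto simp: strict_mono_on_def)
    then have "Delta b (c ` K) = minor (\<lambda>i j. b i (c j)) (sorted_list_of_set K)"
      unfolding Delta_def using fK by (simp add: sorted_list_of_set_image_strict_mono minor_map)
    also have "\<dots> = Delta a K"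
      unfolding Delta_def b_def using fK that inj
      by (intro minor_cong) (auto simp: subset_iff)
    finally show ?thesis .
  qed
  have img: "\<exists>K' \<in> nsets Y k. K = c ` K'" if "K \<in> nsets (c ` Y) k" for K
  proof -
    have "K \<subseteq> c ` Y" using that by (simp add: nsets_def)
    then obtain K' where "K' \<subseteq> Y" "K = c ` K'" by (rule subset_imageE)
    then show ?thesis
      using that inj Y(1) by (intro bexI[of _ K'])
        (auto simp: nsets_def card_image inj_on_subset intro: finite_subset)
  qed
  have sub: "K \<subseteq> Y" if "K \<in> nsets Y k" for K using that by (simp add: nsets_def)
  show ?thesis unfolding jointly_smallest_def
  proof (intro exI[of _ b] conjI ballI)
    show "0 < Delta b K" if "K \<in> nsets (c ` Y) k" for K
      using img[OF that] a(1) same sub by fastforce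
    show "Delta b (c ` A) = Delta b (c ` B)" using a(2) same sub AB by simp
    show "Delta b (c ` A) \<le> Delta b K" if "K \<in> nsets (c ` Y) k" for K
      using img[OF that] a(3) same sub AB by fastforce
  qed
qed

definition steps :: "string \<Rightarrow> bool list" where
  "steps = map (\<lambda>c. c = CHR ''U'')"

text \<open>For \<open>U\<^sup>r D\<^sup>r\<close> the right half of the matrix is, up to signs and order of rows, a Pascal matrix: its
  minors are positive integers and its determinant is \<open>1\<close>, so the two minors in question, equal to
  \<open>1\<close>, are minimal. The other six matrices come from maximizing numerically the gap between the two
  distinguished minors and the rest, followed by rounding.\<close>

definition realizations :: "(bool list \<times> nat \<times> int list list) list" where
  "realizations = [
   (steps ''UD'', 0, [[1,1]]),
   (steps ''UUDD'', 0, [[1,0,-1,-2],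
     [0,1,1,1]]),
   (steps ''UUUDDD'', 0, [[1,0,0,1,3,6],
     [0,1,0,-1,-2,-3],
     [0,0,1,1,1,1]]),
   (steps ''UUUUDDDD'', 0, [[1,0,0,0,-1,-4,-10,-20],
     [0,1,0,0,1,3,6,10],
     [0,0,1,0,-1,-2,-3,-4],
     [0,0,0,1,1,1,1,1]]),
   (steps ''UUUUUDDDDD'', 0, [[1,0,0,0,0,1,5,15,35,70],
     [0,1,0,0,0,-1,-4,-10,-20,-35],
     [0,0,1,0,0,1,3,6,10,15],
     [0,0,0,1,0,-1,-2,-3,-4,-5],
     [0,0,0,0,1,1,1,1,1,1]]),
   (steps ''UUDUUDDD'', 0, [[5,0,0,0,-4,-68,-122,-172],
     [0,3,0,0,3,48,85,118],
     [0,0,12,0,-8,-67,-108,-135],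
     [0,0,0,12,11,11,16,18]]),
   (steps ''UUUDDUDD'', 5, [[4,0,0,0,-4,-36,-72,-82],
     [0,11,0,0,20,167,298,334],
     [0,0,18,0,-25,-187,-302,-334],
     [0,0,0,21,24,23,21,22]]),
   (steps ''UUUUDDUDDD'', 2, [[24,0,0,0,0,35,252,633,885,1055],
     [0,44,0,0,0,-122,-837,-1965,-2646,-3088],
     [0,0,43,0,0,131,841,1849,2428,2797],
     [0,0,0,75,0,-135,-752,-1465,-1860,-2111],
     [0,0,0,0,83,120,75,79,91,100]]),
   (steps ''UUUUDDDUDD'', 3, [[47,0,0,0,0,51,132,566,1370,1144],
     [0,50,0,0,0,-168,-393,-1414,-3038,-2505],
     [0,0,27,0,0,124,270,865,1759,1443],
     [0,0,0,36,0,-114,-228,-630,-1211,-989],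
     [0,0,0,0,58,67,51,42,54,43]]),
   (steps ''UUUDUUDDDD'', 5, [[39,0,0,0,0,81,1947,5512,5765,2427],
     [0,10,0,0,0,-23,-536,-1497,-1547,-637],
     [0,0,15,0,0,31,664,1808,1830,726],
     [0,0,0,12,0,-15,-150,-366,-348,-128],
     [0,0,0,0,36,75,53,115,103,36]]),
   (steps ''UUDUUUDDDD'', 5, [[71,0,0,0,0,35,1750,4174,3712,2154],
     [0,56,0,0,0,-34,-1631,-3857,-3397,-1929],
     [0,0,17,0,0,7,229,506,416,206],
     [0,0,0,21,0,-10,-126,-237,-172,-72],
     [0,0,0,0,255,138,601,1023,684,257]])]"

section \<open>Classification of the Dyck words of semilength at most five\<close>

fun dyck_from :: "nat \<Rightarrow> bool list \<Rightarrow> bool" where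
  "dyck_from h [] = (h = 0)"
| "dyck_from h (True # w) = dyck_from (Suc h) w"
| "dyck_from 0 (False # w) = False"
| "dyck_from (Suc h) (False # w) = dyck_from h w"

fun peaks :: "bool list \<Rightarrow> nat" where
  "peaks (x # y # w) = (if x \<and> \<not> y then 1 else 0) + peaks (y # w)"
| "peaks w = 0"

definition separated_parameters :: "nat list \<Rightarrow> bool" where
  "separated_parameters ls \<longleftrightarrow> (case ls of [\<alpha>\<^sub>1, \<beta>\<^sub>1, \<alpha>\<^sub>2, \<beta>\<^sub>2] \<Rightarrow>
     \<alpha>\<^sub>1 \<noteq> \<beta>\<^sub>1 \<and> \<alpha>\<^sub>1 \<noteq> \<beta>\<^sub>2 \<and> \<alpha>\<^sub>2 \<noteq> \<beta>\<^sub>1 \<and> \<alpha>\<^sub>2 \<noteq> \<beta>\<^sub>2 | _ \<Rightarrow> False)"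

text \<open>The conditional expressions here and below make the simplifier stop at the first decisive test.\<close>

definition exchange_pairs :: "bool list \<Rightarrow> (nat \<times> nat) list \<Rightarrow> (nat \<times> nat) list \<Rightarrow> bool" where
  "exchange_pairs w P Q \<longleftrightarrow> (if P = [] \<or> Q = [] \<or> 2 * (length P + length Q) \<noteq> length w then False
     else if list_all (\<lambda>(x, y). list_all (\<lambda>(u, v). between x u y \<noteq> between x u v) Q) P
     then sort (map fst (P @ Q)) = filter (\<lambda>i. w ! i) [0..<length w] \<and>
       sort (map snd (P @ Q)) = filter (\<lambda>i. \<not> w ! i) [0..<length w]
     else False)"

text \<open>If the steps \<open>is\<close> form a path that stays on one side of its endpoints, then matching the \<open>i\<close>-th up
  step with the \<open>i\<close>-th down step makes all pairs point in the same direction along \<open>is\<close>. For two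
  complementary cyclic intervals on which the directions agree, all pairs cross as required.\<close>

definition matched_steps :: "bool list \<Rightarrow> nat list \<Rightarrow> (nat \<times> nat) list" where
  "matched_steps w is = zip (filter (\<lambda>i. w ! i) is) (filter (\<lambda>i. \<not> w ! i) is)"

fun has_split :: "bool list \<Rightarrow> (nat \<times> nat) list \<Rightarrow> bool" where
  "has_split w [] = False"
| "has_split w ((s, t) # ps) =
     (if exchange_pairs w (matched_steps w [s..<t]) (matched_steps w ([t..<length w] @ [0..<s]))
      then True else has_split w ps)"

definition exceptional_words :: "bool list list" where
  "exceptional_words = [steps ''UUDUDUUDDD'', steps ''UUUDDUDUDD'']"

text \<open>The pairs given explicitly are a matching for \<open>UUDUUDDUDD\<close>, in which the eighth and
  the third step form a group of their own.\<close>

definition obstructed :: "bool list \<Rightarrow> bool" where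
  "obstructed w \<longleftrightarrow> (if has_split w (List.product [0..<length w] [0..<length w]) then True
     else if exchange_pairs w [(7, 2)] [(0, 8), (1, 9), (3, 5), (4, 6)] then True
     else w \<in> set exceptional_words)"

definition classified :: "bool list \<Rightarrow> bool" where
  "classified w \<longleftrightarrow> (if dyck_from 0 w then
     (peaks w = 1 \<longleftrightarrow> w = replicate (length w div 2) True @ replicate (length w div 2) False) \<and>
     (if peaks w = 1 \<or> peaks w = 2 \<and> separated_parameters (run_lengths w)
      then w \<in> set (map fst realizations) else obstructed w) else True)"

lemma realizations_correct: "list_all (\<lambda>(w, c, rs). realized_by w c rs) realizations"
  by code_simp

lemma all_classified:
  "list_all (\<lambda>r. list_all classified (List.n_lists (2 * r) [True, False])) [1, 2, 3, 4, 5]"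
  by code_simp

section \<open>Obstructed words\<close>

lemma has_split_exchange_pairs: "has_split w ps \<Longrightarrow> \<exists>P Q. exchange_pairs w P Q"
  by (induction w ps rule: has_split.induct) (auto split: if_splits)

lemma exchange_pairs_not_smallest:
  assumes ex: "exchange_pairs w P Q" and f: "strictly_exchanging f {..<length w} r" and w: "length w = 2 * r"
    and eq: "f (trues w) = f (trues (map Not w))"
    and le: "\<And>T. T \<in> nsets {..<length w} r \<Longrightarrow> f (trues w) \<le> f T"
  shows False
proof -
  let ?A = "set (map fst P)" and ?B = "set (map snd P)" and ?C = "set (map fst Q)" and ?D = "set (map snd Q)"
  have E: "P \<noteq> []" "Q \<noteq> []" "length P + length Q = r"
    "sort (map fst (P @ Q)) = filter (\<lambda>i. w ! i) [0..<length w]"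
    "sort (map snd (P @ Q)) = filter (\<lambda>i. \<not> w ! i) [0..<length w]"
    using ex w unfolding exchange_pairs_def by (auto split: if_splits)
  have cr: "between x u y \<noteq> between x u v" if "(x, y) \<in> set P" "(u, v) \<in> set Q" for x y u v
    using ex that unfolding exchange_pairs_def list_all_iff by (fastforce split: if_splits)
  have U: "?A \<union> ?C = trues w" "?B \<union> ?D = trues (map Not w)"
    using arg_cong[OF E(4), of set] arg_cong[OF E(5), of set] by (auto simp: trues_def)
  have d: "distinct (map fst (P @ Q))" "distinct (map snd (P @ Q))"
    using arg_cong[OF E(4), of distinct] arg_cong[OF E(5), of distinct] by simp_all
  have disj: "trues w \<inter> trues (map Not w) = {}" by (auto simp: trues_def)
  have sub: "trues w \<subseteq> {..<length w}" "trues (map Not w) \<subseteq> {..<length w}" by (auto simp: trues_def)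
  have dj: "?A \<inter> ?B = {}" "?A \<inter> ?D = {}" "?C \<inter> ?B = {}" "?C \<inter> ?D = {}" using disj U by blast+
  then have dd: "distinct (map fst P @ map snd P @ map fst Q @ map snd Q)"
    using d unfolding map_append distinct_append set_append by blast
  have lt: "f ({} \<union> ?A \<union> ?D) * f ({} \<union> ?B \<union> ?C) < f ({} \<union> ?A \<union> ?C) * f ({} \<union> ?B \<union> ?D)"
    by (rule exchange_pairs_inequality[OF f E(1,2)]) (use E(3) dd U sub cr in auto)
  have cd: "card ?A = length P" "card ?B = length P" "card ?C = length Q" "card ?D = length Q"
    using dd by (metis distinct_append distinct_card length_map)+
  have N: "?A \<union> ?D \<in> nsets {..<length w} r" "?B \<union> ?C \<in> nsets {..<length w} r"
    "trues w \<in> nsets {..<length w} r"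
  proof -
    have "card (?A \<union> ?D) = r" "card (?B \<union> ?C) = r" "card (?A \<union> ?C) = r"
      using card_Un_disjoint[of ?A ?D] card_Un_disjoint[of ?B ?C] card_Un_disjoint[of ?A ?C]
        dj d(1) E(3) cd by (simp_all add: Int_commute)
    then show "?A \<union> ?D \<in> nsets {..<length w} r" "?B \<union> ?C \<in> nsets {..<length w} r"
      "trues w \<in> nsets {..<length w} r"
      using U sub unfolding nsets_def by auto
  qed
  have "0 < f (trues w)" using strictly_exchangingD(1)[OF f N(3)] .
  then have "f (trues w) * f (trues w) \<le> f (?A \<union> ?D) * f (?B \<union> ?C)"
    using le[OF N(1)] le[OF N(2)] by (intro mult_mono) auto
  then show False using lt eq U by simp
qed

text \<open>The four minors on the smaller side of \<open>exceptional_exchange\<close> would each be at least the common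
  minimal value.\<close>

lemma exceptional_not_smallest:
  assumes f: "strictly_exchanging f {..<10} 5"
    and eq: "f {0,1,3,5,6} = f {2,4,7,8,9}"
    and le: "\<And>T. T \<in> nsets {..<10} 5 \<Longrightarrow> f {0,1,3,5,6} \<le> f T"
  shows False
proof -
  let ?m = "f {0,1,3,5,6}"
  have m: "?m \<le> f (set xs)" if "distinct xs" "length xs = 5" "list_all (\<lambda>x. x < 10) xs" for xs
    using that by (intro le) (auto simp: nsets_def distinct_card list_all_iff)
  have "0 < ?m"
    by (rule strictly_exchangingD(1)[OF f]) (auto simp: nsets_def)
  then have mm: "?m * ?m \<le> f {0,1,2,3,4} * f {5,6,7,8,9}" "?m * ?m \<le> f {2,3,4,5,6} * f {0,1,7,8,9}"
    using m[of "[0,1,2,3,4]"] m[of "[5,6,7,8,9]"] m[of "[2,3,4,5,6]"] m[of "[0,1,7,8,9]"]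
    by (auto intro!: mult_mono)
  then have "?m * ?m * (?m * ?m) \<le> f {0,1,2,3,4} * f {5,6,7,8,9} * (f {2,3,4,5,6} * f {0,1,7,8,9})"
    by (rule mult_mono[OF _ _ order_trans[OF zero_le_square mm(1)] zero_le_square])
  then show False using exceptional_exchange[OF f] eq by (simp add: power2_eq_square)
qed

lemma obstructed_not_smallest:
  assumes ob: "obstructed w" and f: "strictly_exchanging f {..<length w} r" and w: "length w = 2 * r"
    and eq: "f (trues w) = f (trues (map Not w))"
    and le: "\<And>T. T \<in> nsets {..<length w} r \<Longrightarrow> f (trues w) \<le> f T"
  shows False
proof -
  consider P Q where "exchange_pairs w P Q" | "w = steps ''UUDUDUUDDD''" | "w = steps ''UUUDDUDUDD''"
    using ob has_split_exchange_pairs unfolding obstructed_def exceptional_words_def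
    by (auto split: if_splits)
  then show False
  proof cases
    case 1 then show False using exchange_pairs_not_smallest[OF _ f w eq le] by blast
  next
    case 2
    have "trues w = {0,1,3,5,6}" "trues (map Not w) = {2,4,7,8,9}" "length w = 10"
      unfolding 2 by (auto simp: steps_def trues_Cons)
    then show False using exceptional_not_smallest[of f] f eq le w by simp
  next
    case 3
    have t: "trues w = {0,1,2,5,7}" "trues (map Not w) = {3,4,6,8,9}" "length w = 10"
      unfolding 3 by (auto simp: steps_def trues_Cons)
    have r: "r = 5" using w t by simp
    let ?\<rho> = "\<lambda>i::nat. 9 - i"
    have bij: "inj_on ?\<rho> {..<10}" by (rule inj_onI) auto
    have g: "strictly_exchanging (\<lambda>T. f ({} \<union> ?\<rho> ` T)) {..<10} 5"
      by (rule strictly_exchanging_relabel[OF f[unfolded t r]])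
         (auto simp: between_def intro: bij)
    show False
    proof (rule exceptional_not_smallest[OF g])
      have i: "?\<rho> ` {0,1,3,5,6} = {3,4,6,8,9}" "?\<rho> ` {2,4,7,8,9} = {0,1,2,5,7}" by auto
      show "f ({} \<union> ?\<rho> ` {0,1,3,5,6}) = f ({} \<union> ?\<rho> ` {2,4,7,8,9})"
        unfolding i using eq t by simp
      show "f ({} \<union> ?\<rho> ` {0,1,3,5,6}) \<le> f ({} \<union> ?\<rho> ` T)" if T: "T \<in> nsets {..<10} 5" for T
      proof -
        have "card (?\<rho> ` T) = 5" using T bij by (auto simp: nsets_def card_image inj_on_subset)
        then have "?\<rho> ` T \<in> nsets {..<10} 5" using T by (auto simp: nsets_def)
        then show ?thesis unfolding i using le[of "?\<rho> ` T"] eq t r by simp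
      qed
    qed
  qed
qed

section \<open>From words to pairs of sets\<close>

definition word :: "nat set \<Rightarrow> nat set \<Rightarrow> bool list" where
  "word I J = map (\<lambda>c. c \<in> I) (sorted_list_of_set (I - J \<union> (J - I)))"

lemma lattice_path_word:
  assumes "finite I" "finite J"
  shows "lattice_path I J = map (\<lambda>b. if b then up_step else down_step) (word I J)"
  unfolding lattice_path_def word_def using assms by auto

lemma word_labels:
  assumes "finite I" "finite J"
  defines "cs \<equiv> sorted_list_of_set (I - J \<union> (J - I))"
  shows "length (word I J) = card (I - J) + card (J - I)"
    and "(!) cs ` trues (word I J) = I - J"
    and "(!) cs ` trues (map Not (word I J)) = J - I"
    and "(!) cs ` {..<length (word I J)} = I - J \<union> (J - I)"
    and "strict_mono_on {..<length (word I J)} ((!) cs)"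
proof -
  have set: "set cs = I - J \<union> (J - I)" unfolding cs_def using assms by simp
  have len: "length (word I J) = length cs" by (simp add: word_def cs_def)
  have nth: "word I J ! j = (cs ! j \<in> I)" if "j < length cs" for j
    using that by (simp add: word_def cs_def)
  have "length cs = card (I - J \<union> (J - I))" by (simp add: cs_def)
  also have "\<dots> = card (I - J) + card (J - I)" using assms by (intro card_Un_disjoint) auto
  finally show "length (word I J) = card (I - J) + card (J - I)" using len by simp
  show all: "(!) cs ` {..<length (word I J)} = I - J \<union> (J - I)"
    unfolding len set[symmetric] by (auto simp: set_conv_nth)
  have "(!) cs ` trues (word I J) = {x \<in> set cs. x \<in> I}"
    by (auto simp: trues_def len nth in_set_conv_nth image_iff) 
  then show "(!) cs ` trues (word I J) = I - J" unfolding set by auto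
  have "(!) cs ` trues (map Not (word I J)) = {x \<in> set cs. x \<notin> I}"
    by (auto simp: trues_def len nth in_set_conv_nth image_iff) 
  then show "(!) cs ` trues (map Not (word I J)) = J - I" unfolding set by auto
  have "strict_sorted cs" by (simp add: cs_def)
  then show "strict_mono_on {..<length (word I J)} ((!) cs)"
    unfolding len by (auto simp: strict_mono_on_def sorted_wrt_iff_nth_less)
qed

lemma card_differences:
  assumes "I \<in> nsets X k" "J \<in> nsets X k"
  shows "card (I - J) = card (J - I)" "card (I - J) + card (I \<inter> J) = k"
proof -
  have *: "card (A - B) + card (A \<inter> B) = card A" if "finite A" for A B :: "'b set"
    using that by (metis Int_Diff_Un Int_Diff_disjoint add.commute card_Un_disjoint finite_Diff finite_Int)
  show "card (I - J) + card (I \<inter> J) = k" using *[of I J] assms by (simp add: nsets_def)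
  then show "card (I - J) = card (J - I)" using *[of J I] assms by (simp add: nsets_def Int_commute)
qed

text \<open>Contract \<open>I \<inter> J\<close> and delete the labels outside \<open>I \<union> J\<close>: what remains is a function on subsets of the
  positions of the word.\<close>

lemma not_jointly_smallest:
  assumes IJ: "I \<in> nsets X k" "J \<in> nsets X k" and ob: "obstructed (word I J)"
  shows "\<not> jointly_smallest k X I J"
proof
  assume "jointly_smallest k X I J"
  then obtain a where a: "\<And>K. K \<in> nsets X k \<Longrightarrow> 0 < Delta a K" "Delta a I = Delta a J"
    "\<And>K. K \<in> nsets X k \<Longrightarrow> Delta a I \<le> Delta a K"
    unfolding jointly_smallest_def by blast
  have fin: "finite I" "finite J" and sub: "I \<subseteq> X" "J \<subseteq> X" using IJ by (auto simp: nsets_def)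
  define c where "c = (!) (sorted_list_of_set (I - J \<union> (J - I)))"
  define r where "r = card (I - J)"
  note W = word_labels[OF fin, folded c_def]
  note cd = card_differences[OF IJ]
  let ?w = "word I J"
  let ?f = "\<lambda>T. Delta a (I \<inter> J \<union> c ` T)"
  have len: "length ?w = 2 * r" using W(1) cd(1) by (simp add: r_def)
  have inj: "inj_on c {..<length ?w}" using W(5) by (rule strict_mono_on_imp_inj_on)
  have less: "c x < c y \<longleftrightarrow> x < y" if "x < length ?w" "y < length ?w" for x y
    using W(5) that by (auto simp: strict_mono_on_def) (metis lessThan_iff linorder_neqE_nat order.asym)
  have f: "strictly_exchanging ?f {..<length ?w} r"
  proof (rule strictly_exchanging_relabel[OF Delta_strictly_exchanging[OF a(1)]])
    show "card (I \<inter> J) + r = k" using cd by (simp add: r_def)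
    show "c ` {..<length ?w} \<subseteq> X - I \<inter> J" unfolding W(4) using sub by auto
    show "between (c x) (c y) (c z) = between x y z"
      if "x \<in> {..<length ?w}" "y \<in> {..<length ?w}" "z \<in> {..<length ?w}" for x y z
      using that less by (simp add: between_def)
  qed (use fin sub inj in auto)
  have "I \<inter> J \<union> (I - J) = I" "I \<inter> J \<union> (J - I) = J" by auto
  then have fI: "?f (trues ?w) = Delta a I" "?f (trues (map Not ?w)) = Delta a J"
    using W(2,3) by simp_all
  show False
  proof (rule obstructed_not_smallest[OF ob f len])
    show "?f (trues ?w) = ?f (trues (map Not ?w))" unfolding fI by (rule a(2))
    show "?f (trues ?w) \<le> ?f T" if T: "T \<in> nsets {..<length ?w} r" for T
    proof -
      have "card (I \<inter> J \<union> c ` T) = card (I \<inter> J) + card (c ` T)"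
        using T W(4) fin by (intro card_Un_disjoint) (auto simp: nsets_def)
      also have "card (c ` T) = r" using T inj by (auto simp: nsets_def card_image inj_on_subset)
      finally have "card (I \<inter> J \<union> c ` T) = k" using cd by (simp add: r_def)
      moreover have "c ` T \<subseteq> I - J \<union> (J - I)" "finite T"
        using T image_mono[of T "{..<length ?w}" c] W(4) by (auto simp: nsets_def)
      ultimately have "I \<inter> J \<union> c ` T \<in> nsets X k"
        using fin sub unfolding nsets_def by auto
      then show ?thesis unfolding fI by (rule a(3))
    qed
  qed
qed

lemma realized_jointly_smallest:
  assumes IJ: "I \<in> nsets X k" "J \<in> nsets X k" and X: "finite X"
    and w: "word I J \<in> set (map fst realizations)"
  shows "jointly_smallest k X I J"
proof -
  obtain c rs where "(word I J, c, rs) \<in> set realizations" using w by auto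
  then have R: "realized_by (word I J) c rs" using realizations_correct by (auto simp: list_all_iff)
  have fin: "finite I" "finite J" using IJ by (auto simp: nsets_def)
  note W = word_labels[OF fin] and cd = card_differences[OF IJ]
  let ?w = "word I J"
  have rs: "card (trues ?w) = length rs" "length ?w = 2 * length rs"
    using R by (simp_all add: realized_by_def Let_def card_trues_filter)
  have r: "card (I - J) = length rs" using W(1) cd(1) rs(2) by simp
  have "trues ?w \<in> nsets {..<length ?w} (length rs)" "trues (map Not ?w) \<in> nsets {..<length ?w} (length rs)"
  proof -
    have "trues (map Not ?w) = {..<length ?w} - trues ?w" "trues ?w \<subseteq> {..<length ?w}"
      by (auto simp: trues_def)
    then show "trues ?w \<in> nsets {..<length ?w} (length rs)"
      "trues (map Not ?w) \<in> nsets {..<length ?w} (length rs)"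
      using rs by (simp_all add: nsets_def card_Diff_subset)
  qed
  from jointly_smallest_relabel[OF realized_by_jointly_smallest[OF R] _ W(5) this]
  have "jointly_smallest (length rs) (I - J \<union> (J - I)) (I - J) (J - I)"
    unfolding W(2,3,4) by simp
  then show ?thesis using jointly_smallest_extend X IJ r by blast
qed

section \<open>Points of the positive Grassmannian\<close>

lemma pick_sorted_list_of_set:
  assumes "finite S" "j < card S"
  shows "pick S j = sorted_list_of_set S ! j"
proof -
  let ?x = "pick S j"
  have x: "?x \<in> S" "card {y \<in> S. y < ?x} = j" using assms pick_in_set[of j S] card_pick[of j S] by auto
  obtain us vs where s: "sorted_list_of_set (insert ?x S) = us @ ?x # vs" "length us = card {y \<in> S. y < ?x}"
    using sorted_list_split[OF assms(1)] by metis
  have "insert ?x S = S" using x(1) by auto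
  then show ?thesis using s x(2) by (metis nth_append_length)
qed

lemma pluecker_Delta:
  assumes A: "A \<in> carrier_mat k n" and K: "K \<in> nsets {1..n} k"
  shows "pluecker A K = Delta (\<lambda>i x. A $$ (i, x - 1)) K"
proof -
  let ?K = "(\<lambda>i. i - 1) ` K"
  have fK: "finite K" "card K = k" "K \<subseteq> {1..n}" using K by (auto simp: nsets_def)
  have mono: "strict_mono_on K (\<lambda>i. i - 1 :: nat)"
  proof (rule strict_mono_onI)
    fix x y assume "x \<in> K" "y \<in> K" "x < y"
    then show "x - 1 < y - 1" using fK(3) by (auto simp: subset_iff intro: diff_less_mono)
  qed
  have cK: "card ?K = k" using mono fK by (simp add: card_image strict_mono_on_imp_inj_on)
  have "x - 1 < n" if "x \<in> K" for x using that fK(3) by fastforce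
  then have "{j. j < dim_col A \<and> j \<in> ?K} = ?K" using A by auto
  then have cols: "card {j. j < dim_col A \<and> j \<in> ?K} = k" using cK by simp
  have "submatrix A UNIV ?K = mat k k (\<lambda>(i, j). A $$ (i, sorted_list_of_set K ! j - 1))"
  proof (rule eq_matI)
    fix i j assume "i < dim_row (mat k k (\<lambda>(i, j). A $$ (i, sorted_list_of_set K ! j - 1)))"
      "j < dim_col (mat k k (\<lambda>(i, j). A $$ (i, sorted_list_of_set K ! j - 1)))"
    then have ij: "i < k" "j < k" by simp_all
    have "pick ?K j = sorted_list_of_set ?K ! j" using ij fK cK by (intro pick_sorted_list_of_set) auto
    also have "\<dots> = sorted_list_of_set K ! j - 1"
      unfolding sorted_list_of_set_image_strict_mono[OF fK(1) mono] using ij fK by simp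
    finally have p: "pick ?K j = sorted_list_of_set K ! j - 1" .
    note cols
    moreover have "card {i. i < dim_row A \<and> i \<in> UNIV} = k" using A by simp
    ultimately have "submatrix A UNIV ?K $$ (i, j) = A $$ (pick UNIV i, pick ?K j)"
      using ij by (intro submatrix_index) simp_all
    then show "submatrix A UNIV ?K $$ (i, j)
        = mat k k (\<lambda>(i, j). A $$ (i, sorted_list_of_set K ! j - 1)) $$ (i, j)"
      using ij by (simp only: p pick_UNIV) simp
  qed (use A cols in \<open>simp_all add: dim_submatrix\<close>)
  then show ?thesis unfolding pluecker_def Delta_def minor_def using fK by simp
qed

lemma pluecker_row_operation:
  assumes A: "A \<in> carrier_mat k n" and P: "P \<in> carrier_mat k k" and K: "K \<in> nsets {1..n} k"
  shows "pluecker (P * A) K = det P * pluecker A K"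
proof -
  have fK: "finite K" "card K = k" "K \<subseteq> {1..n}" using K by (auto simp: nsets_def)
  let ?xs = "sorted_list_of_set K"
  have x: "?xs ! j - 1 < n" if "j < k" for j
  proof -
    have "?xs ! j \<in> K" using that fK by (metis length_sorted_list_of_set nth_mem set_sorted_list_of_set)
    then show ?thesis using fK(3) by (auto simp: subset_iff)
  qed
  have "mat k k (\<lambda>(i, j). (P * A) $$ (i, ?xs ! j - 1)) = P * mat k k (\<lambda>(i, j). A $$ (i, ?xs ! j - 1))"
    using A P x by (intro eq_matI) (auto simp: scalar_prod_def)
  then show ?thesis
    using pluecker_Delta[OF A K] pluecker_Delta[OF mult_carrier_mat[OF P A] K] P fK
    by (simp add: Delta_def minor_def det_mult[of _ k])
qed

lemma (in vec_space) rank_le_nr: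
  assumes "A \<in> carrier_mat n nc"
  shows "rank A \<le> n"
proof -
  obtain S where S: "maximal S (\<lambda>T. T \<subseteq> set (cols A) \<and> lin_indpt T)"
    using maximal_exists[of "(\<lambda>T. T \<subseteq> set (cols A) \<and> lin_indpt T)" "card (set (cols A))" "{}"]
    by (meson List.finite_set card_mono empty_iff empty_subsetI finite_lin_indpt2 rev_finite_subset)
  then have "S \<subseteq> carrier_vec n" "lin_indpt S"
    using cols_dim[of A] assms unfolding maximal_def by auto
  then have "card S \<le> dim" using li_le_dim(2) fin_dim by auto
  then show ?thesis using rank_card_indpt[OF assms S] dim_is_n by simp
qed

text \<open>Given a positive matrix with \<open>\<Delta>\<^sub>I = \<Delta>\<^sub>J\<close> minimal, the arrangement consists of all sets at which the
  minimum is attained. A row operation \<open>P\<close> multiplies all minors by \<open>det P\<close>, so the sign condition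
  holds for every matrix that represents the same point.\<close>

lemma arrangement_iff_jointly_smallest:
  assumes IJ: "I \<in> nsets {1..n} k" "J \<in> nsets {1..n} k"
  shows "(\<exists>S. arrangement_of_smallest_minors k n S \<and> I \<in> S \<and> J \<in> S) \<longleftrightarrow> jointly_smallest k {1..n} I J"
proof
  assume "\<exists>S. arrangement_of_smallest_minors k n S \<and> I \<in> S \<and> J \<in> S"
  then obtain S V A where S: "S \<subseteq> nsets {1..n} k" "I \<in> S" "J \<in> S" and V: "V \<in> pos_Grassmannian k n" "A \<in> V"
    and pos: "\<forall>K \<in> nsets {1..n} k. pluecker A K > 0"
    and eq: "\<forall>K \<in> S. \<forall>K' \<in> S. pluecker A K = pluecker A K'"
    and gt: "\<forall>K \<in> S. \<forall>K' \<in> nsets {1..n} k - S. pluecker A K' > pluecker A K"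
    unfolding arrangement_of_smallest_minors_def by blast
  have "A \<in> carrier_mat k n"
    using V unfolding pos_Grassmannian_def Grassmannian_def quotient_def row_equiv_def full_rank_mats_def by auto
  note D = pluecker_Delta[OF this]
  have "pluecker A I \<le> pluecker A K" if "K \<in> nsets {1..n} k" for K
  proof (cases "K \<in> S")
    case True
    then have "pluecker A I = pluecker A K" using eq S(2) by blast
    then show ?thesis by simp
  next
    case False
    then have "pluecker A I < pluecker A K" using that gt S(2) by blast
    then show ?thesis by simp
  qed
  moreover have "pluecker A I = pluecker A J" using eq S by blast
  ultimately show "jointly_smallest k {1..n} I J" unfolding jointly_smallest_def
    using pos IJ D by (intro exI[of _ "\<lambda>i x. A $$ (i, x - 1)"]) simp
next
  assume "jointly_smallest k {1..n} I J"
  then obtain a where a: "\<And>K. K \<in> nsets {1..n} k \<Longrightarrow> 0 < Delta a K" "Delta a I = Delta a J"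
    "\<And>K. K \<in> nsets {1..n} k \<Longrightarrow> Delta a I \<le> Delta a K"
    unfolding jointly_smallest_def by blast
  define A where "A = mat k n (\<lambda>(i, j). a i (Suc j))"
  have A: "A \<in> carrier_mat k n" by (simp add: A_def)
  have D: "pluecker A K = Delta a K" if K: "K \<in> nsets {1..n} k" for K
    unfolding pluecker_Delta[OF A K] using K
    by (intro Delta_cong) (auto simp: A_def nsets_def subset_iff)
  have rank: "vec_space.rank k A = k"
  proof (rule antisym)
    show "vec_space.rank k A \<le> k" using A by (rule vec_space.rank_le_nr)
    let ?I = "(\<lambda>i. i - 1) ` I"
    have "1 \<le> x" if "x \<in> I" for x using IJ(1) that by (auto simp: nsets_def)
    then have "inj_on (\<lambda>i. i - 1 :: nat) I" by (intro inj_onI) (metis eq_diff_iff)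
    then have "card ?I = k" using IJ(1) by (simp add: card_image nsets_def)
    moreover have "x - 1 < n" if "x \<in> I" for x using IJ(1) that by (fastforce simp: nsets_def)
    then have "{j. j < n \<and> j \<in> ?I} = ?I" by auto
    moreover have "det (submatrix A UNIV ?I) \<noteq> 0"
      using D[OF IJ(1)] a(1)[OF IJ(1)] by (simp add: pluecker_def)
    ultimately show "k \<le> vec_space.rank k A"
      using vec_space.rank_gt_minor[OF A, of UNIV ?I] by simp
  qed
  then have fr: "A \<in> full_rank_mats k n" using A by (simp add: full_rank_mats_def)
  define V where "V = row_equiv k n `` {A}"
  have "V \<in> Grassmannian k n" unfolding V_def Grassmannian_def using fr by (rule quotientI)
  moreover have "(\<forall>K \<in> nsets {1..n} k. pluecker B K > 0) \<or> (\<forall>K \<in> nsets {1..n} k. pluecker B K < 0)"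
    if B: "B \<in> V" for B
  proof -
    obtain P where P: "P \<in> carrier_mat k k" "invertible_mat P" "B = P * A"
      using B unfolding V_def row_equiv_def by auto
    have "det P \<noteq> 0"
    proof -
      obtain Q where Q: "P * Q = 1\<^sub>m k" "Q * P = 1\<^sub>m (dim_row Q)"
        using P by (auto simp: invertible_mat_def inverts_mat_def)
      have "dim_col Q = k" using arg_cong[OF Q(1), of dim_col] by simp
      moreover have "dim_row Q = k" using arg_cong[OF Q(2), of dim_col] P(1) by simp
      ultimately have "det P * det Q = 1" using det_mult[OF P(1), of Q] Q(1) by auto
      then show ?thesis by auto
    qed
    then show ?thesis
      using pluecker_row_operation[OF A P(1)] P(3) D a(1)
      by (cases "det P > 0") (auto simp: mult_neg_pos)
  qed
  moreover have "A \<in> V"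
  proof -
    have "A = 1\<^sub>m k * A" "1\<^sub>m k \<in> carrier_mat k k" using A by auto
    moreover have "invertible_mat (1\<^sub>m k :: real mat)"
      unfolding invertible_mat_def inverts_mat_def by (intro conjI exI[of _ "1\<^sub>m k"]) simp_all
    ultimately show ?thesis unfolding V_def row_equiv_def using fr by auto
  qed
  ultimately have V: "V \<in> pos_Grassmannian k n" "A \<in> V" by (auto simp: pos_Grassmannian_def)
  let ?S = "{K \<in> nsets {1..n} k. Delta a K = Delta a I}"
  have "arrangement_of_smallest_minors k n ?S"
    unfolding arrangement_of_smallest_minors_def
  proof (intro conjI bexI[OF _ V(1)] bexI[OF _ V(2)] ballI)
    show "pluecker A K > pluecker A K'" if "K' \<in> ?S" "K \<in> nsets {1..n} k - ?S" for K K'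
      using that D a(3)[of K] by (auto simp: less_le)
  qed (use IJ D a in auto)
  then show "\<exists>S. arrangement_of_smallest_minors k n S \<and> I \<in> S \<and> J \<in> S"
    using IJ a(2) by (intro exI[of _ ?S]) simp
qed

section \<open>Lattice paths and weak separation\<close>

definition step :: "bool \<Rightarrow> int \<times> int" where
  "step b = (if b then up_step else down_step)"

lemma step_eq_iff [simp]: "step b = up_step \<longleftrightarrow> b" "step b = down_step \<longleftrightarrow> \<not> b" "step b = step b' \<longleftrightarrow> b = b'"
  by (auto simp: step_def up_step_def down_step_def)

lemma snd_step: "snd (step b) = (if b then 1 else - 1)"
  by (simp add: step_def up_step_def down_step_def)

lemma dyck_from_heights:
  assumes "\<forall>i \<le> length w. 0 \<le> int h + snd (sum_list (take i (map step w)))"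
    and "int h + snd (sum_list (map step w)) = 0"
  shows "dyck_from h w"
  using assms
proof (induction h w rule: dyck_from.induct)
  case (1 h) then show ?case by simp
next
  case (2 h w)
  show ?case unfolding dyck_from.simps
  proof (rule "2.IH")
    show "\<forall>i \<le> length w. 0 \<le> int (Suc h) + snd (sum_list (take i (map step w)))"
    proof (intro allI impI)
      fix i assume "i \<le> length w"
      then show "0 \<le> int (Suc h) + snd (sum_list (take i (map step w)))"
        using "2.prems"(1)[rule_format, of "Suc i"] by (simp add: snd_step)
    qed
    show "int (Suc h) + snd (sum_list (map step w)) = 0"
      using "2.prems"(2) by (simp add: snd_step)
  qed
next
  case (3 w)
  then show ?case using "3.prems"(1)[rule_format, of 1] by (simp add: snd_step)
next
  case (4 h w)
  show ?case unfolding dyck_from.simps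
  proof (rule "4.IH")
    show "\<forall>i \<le> length w. 0 \<le> int h + snd (sum_list (take i (map step w)))"
    proof (intro allI impI)
      fix i assume "i \<le> length w"
      then show "0 \<le> int h + snd (sum_list (take i (map step w)))"
        using "4.prems"(1)[rule_format, of "Suc i"] by (simp add: snd_step)
    qed
    show "int h + snd (sum_list (map step w)) = 0"
      using "4.prems"(2) by (simp add: snd_step)
  qed
qed

lemma final_height:
  "snd (sum_list (map step w)) = int (card (trues w)) - int (card (trues (map Not w)))"
  by (induction w) (auto simp: card_trues_Cons snd_step)

lemma card_picks: "card (picks (map step w)) = peaks w"
proof (induction w rule: peaks.induct)
  case (1 x y w)
  define Q where "Q = picks (map step (y # w))"
  have eq: "picks (map step (x # y # w)) = (if x \<and> \<not> y then {1} else {}) \<union> Suc ` Q"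
    unfolding Q_def
  proof (rule Set.set_eqI)
    fix i
    show "i \<in> picks (map step (x # y # w)) \<longleftrightarrow>
      i \<in> (if x \<and> \<not> y then {1} else {}) \<union> Suc ` picks (map step (y # w))"
    proof (cases i)
      case 0 then show ?thesis by (auto simp: picks_def)
    next
      case (Suc j)
      then show ?thesis by (cases j) (auto simp: picks_def image_iff)
    qed
  qed
  have "finite Q" unfolding Q_def
    by (rule finite_subset[of _ "{..<length (map step (y # w))}"]) (auto simp: picks_def)
  moreover have "1 \<notin> Suc ` Q" by (auto simp: Q_def picks_def)
  moreover have "card Q = peaks (y # w)" using 1 by (simp add: Q_def)
  ultimately show ?case unfolding eq by (cases "x \<and> \<not> y") (auto simp: card_image)
qed (auto simp: picks_def)

lemma run_lengths_map_step: "run_lengths (map step w) = run_lengths w"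
proof (induction w rule: run_lengths.induct)
  case (2 x xs)
  have "takeWhile (\<lambda>y. y = step x) (map step xs) = map step (takeWhile (\<lambda>y. y = x) xs)"
    "dropWhile (\<lambda>y. y = step x) (map step xs) = map step (dropWhile (\<lambda>y. y = x) xs)"
    by (simp_all add: takeWhile_map dropWhile_map comp_def)
  then show ?case using 2 by simp
qed simp

lemma dyck_from_last: "\<not> dyck_from h (w @ [True])"
  by (induction h w rule: dyck_from.induct) auto

text \<open>A Dyck word begins with an up step and ends with a down step. This rules out every pattern
  allowed by weak separation in which one set surrounds the other.\<close>

lemma weakly_separated_word:
  assumes fin: "finite I" "finite J" and cd: "card (I - J) = card (J - I)"
    and dyck: "dyck_from 0 (word I J)"
  shows "weakly_separated I J \<longleftrightarrow> word I J = replicate (card (I - J)) True @ replicate (card (I - J)) False"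
proof -
  define as where "as = sorted_list_of_set (I - J)"
  define bs where "bs = sorted_list_of_set (J - I)"
  define cs where "cs = sorted_list_of_set (I - J \<union> (J - I))"
  define r where "r = card (I - J)"
  let ?p = "\<lambda>c. c \<in> I"
  have sets: "set as = I - J" "set bs = J - I" and len: "length as = r" "length bs = r"
    using fin cd by (simp_all add: as_def bs_def r_def)
  have all: "map ?p (take s as) = replicate (length (take s as)) True"
    "map ?p (drop s as) = replicate (length (drop s as)) True"
    "map ?p (take s bs) = replicate (length (take s bs)) False"
    "map ?p (drop s bs) = replicate (length (drop s bs)) False" for s
    using set_take_subset[of s as] set_drop_subset[of s as] set_take_subset[of s bs]
      set_drop_subset[of s bs] unfolding sets by (auto intro!: replicate_eqI)
  have whole: "map ?p as = replicate r True" "map ?p bs = replicate r False"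
    using all(1)[of r] all(3)[of r] len by simp_all
  have cs: "cs = xs" if "sorted_wrt (<) xs" "set xs = I - J \<union> (J - I)" for xs
    unfolding cs_def using that by (metis sorted_list_of_set.idem_if_sorted_distinct strict_sorted_iff)
  show ?thesis unfolding weakly_separated_def Let_def as_def[symmetric] bs_def[symmetric] r_def[symmetric]
  proof
    assume "word I J = replicate r True @ replicate r False"
    then have w: "map ?p cs = replicate r True @ replicate r False" by (simp add: word_def cs_def)
    have sc: "sorted_wrt (<) cs" "set cs = I - J \<union> (J - I)" using fin by (simp_all add: cs_def)
    have "map ?p (take r cs) = replicate r True" "map ?p (drop r cs) = replicate r False"
      using arg_cong[OF w, of "take r"] arg_cong[OF w, of "drop r"] by (simp_all add: take_map drop_map)
    then have "\<forall>x \<in> set (take r cs). x \<in> I" "\<forall>x \<in> set (drop r cs). x \<notin> I"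
      by (metis in_set_replicate imageI list.set_map)+
    moreover have "set (take r cs) \<union> set (drop r cs) = I - J \<union> (J - I)"
      using sc(2) by (metis append_take_drop_id set_append)
    ultimately have "set (take r cs) = I - J" "set (drop r cs) = J - I" by auto
    moreover have "sorted_wrt (<) (take r cs)" "sorted_wrt (<) (drop r cs)"
      using sc(1) by (simp_all add: sorted_wrt_take sorted_wrt_drop)
    ultimately have "as = take r cs" "bs = drop r cs"
      unfolding as_def bs_def by (metis sorted_list_of_set.idem_if_sorted_distinct strict_sorted_iff)+
    then have "sorted_wrt (<) (take r as @ bs @ drop r as)" using sc(1) len by simp
    then show "(\<exists>s\<le>length as. sorted_wrt (<) (take s as @ bs @ drop s as)) \<or>
        (\<exists>s\<le>length bs. sorted_wrt (<) (take s bs @ as @ drop s bs))" using len by blast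
  next
    assume "(\<exists>s\<le>length as. sorted_wrt (<) (take s as @ bs @ drop s as)) \<or>
        (\<exists>s\<le>length bs. sorted_wrt (<) (take s bs @ as @ drop s bs))"
    then show "word I J = replicate r True @ replicate r False"
    proof (elim disjE exE conjE)
      fix s assume s: "s \<le> length as" "sorted_wrt (<) (take s as @ bs @ drop s as)"
      have "set (take s as @ bs @ drop s as) = I - J \<union> (J - I)"
        using sets by (metis append_take_drop_id set_append sup_assoc sup_commute)
      then have "cs = take s as @ bs @ drop s as" by (rule cs[OF s(2)])
      then have w: "word I J = replicate s True @ replicate r False @ replicate (r - s) True"
        using s len by (simp add: word_def cs_def[symmetric] all whole min_def)
      show ?thesis
      proof (cases "s = r")
        case False
        then obtain d where "r - s = Suc d" using s len by (metis Suc_diff_Suc le_neq_implies_less)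
        then have "word I J = (replicate s True @ replicate r False @ replicate d True) @ [True]"
          using w by (simp add: replicate_append_same)
        then show ?thesis using dyck dyck_from_last by metis
      qed (use w in simp)
    next
      fix s assume s: "s \<le> length bs" "sorted_wrt (<) (take s bs @ as @ drop s bs)"
      have "set (take s bs @ as @ drop s bs) = I - J \<union> (J - I)"
        using sets by (metis append_take_drop_id set_append sup_assoc sup_commute)
      then have "cs = take s bs @ as @ drop s bs" by (rule cs[OF s(2)])
      then have w: "word I J = replicate s False @ replicate r True @ replicate (r - s) False"
        using s len by (simp add: word_def cs_def[symmetric] all whole min_def)
      show ?thesis
      proof (cases s)
        case (Suc d)
        then show ?thesis using w dyck by simp
      qed (use w in simp)
    qed
  qed
qed

theorem theorem12p11:
  fixes k n :: nat and I J :: "nat set"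
  assumes "1 \<le> k" and "k \<le> n"
    and "k \<le> 5 \<or> int k \<ge> int n - 5"
    and "I \<in> nsets {1..n} k" and "J \<in> nsets {1..n} k"
    and "I \<noteq> J"
    and "dyck_path (lattice_path I J)"
  shows "((\<exists>S. arrangement_of_smallest_minors k n S \<and> I \<in> S \<and> J \<in> S) \<longleftrightarrow>
            interlaced 1 I J \<or>
            (interlaced 2 I J \<and>
              (\<exists>\<alpha>\<^sub>1 \<beta>\<^sub>1 \<alpha>\<^sub>2 \<beta>\<^sub>2. length_parameters I J = [\<alpha>\<^sub>1, \<beta>\<^sub>1, \<alpha>\<^sub>2, \<beta>\<^sub>2] \<and>
                 \<alpha>\<^sub>1 \<noteq> \<beta>\<^sub>1 \<and> \<alpha>\<^sub>1 \<noteq> \<beta>\<^sub>2 \<and> \<alpha>\<^sub>2 \<noteq> \<beta>\<^sub>1 \<and> \<alpha>\<^sub>2 \<noteq> \<beta>\<^sub>2)))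
         \<and> (interlaced 1 I J \<longleftrightarrow> weakly_separated I J)"
proof -
  note IJ = assms(4,5)
  have fin: "finite I" "finite J" and sub: "I \<subseteq> {1..n}" "J \<subseteq> {1..n}" and card: "card I = k" "card J = k"
    using IJ by (auto simp: nsets_def)
  note cd = card_differences[OF IJ]
  define r where "r = card (I - J)"
  let ?w = "word I J"
  have path: "lattice_path I J = map step ?w"
    unfolding lattice_path_word[OF fin] step_def[abs_def] ..
  note W = word_labels[OF fin]
  have len: "length ?w = 2 * r" using W(1) cd(1) by (simp add: r_def)
  have ne: "I - J \<noteq> {}"
    using assms(6) card fin card_subset_eq[of J I] by auto
  have r1: "1 \<le> r" using ne fin by (simp add: r_def Suc_le_eq card_gt_0_iff)
  have r5: "r \<le> 5"
  proof -
    have "r \<le> k" using cd(2) by (simp add: r_def)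
    moreover have "card (J - I) + card I \<le> n"
    proof -
      have "card (J - I) + card I = card (J - I \<union> I)" using fin by (subst card_Un_disjoint) auto
      also have "\<dots> \<le> card {1..n}" using sub by (intro card_mono) auto
      finally show ?thesis by simp
    qed
    ultimately show ?thesis using assms(3) cd(1) card by (auto simp: r_def)
  qed
  have dyck: "dyck_from 0 ?w"
  proof (rule dyck_from_heights)
    show "\<forall>i \<le> length ?w. 0 \<le> int 0 + snd (sum_list (take i (map step ?w)))"
      using assms(7) by (simp add: path dyck_path_def path_vertex_def)
    have inj: "inj_on ((!) (sorted_list_of_set (I - J \<union> (J - I)))) {..<length ?w}"
      using W(5) by (rule strict_mono_on_imp_inj_on)
    have "trues ?w \<subseteq> {..<length ?w}" "trues (map Not ?w) \<subseteq> {..<length ?w}"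
      by (auto simp: trues_def)
    then have "card (trues ?w) = card (I - J)" "card (trues (map Not ?w)) = card (J - I)"
      using card_image[OF inj_on_subset[OF inj]] W(2,3) by metis+
    then show "int 0 + snd (sum_list (map step ?w)) = 0" using cd(1) by (simp add: final_height)
  qed
  have "?w \<in> set (List.n_lists (2 * r) [True, False])" using len by (auto simp: set_n_lists)
  moreover have "r \<in> set [1, 2, 3, 4, 5]" using r1 r5 by auto
  ultimately have cl: "classified ?w" using all_classified unfolding list_all_iff by blast
  have half: "length ?w div 2 = r" using len by simp
  have "(peaks ?w = 1 \<longleftrightarrow> ?w = replicate r True @ replicate r False) \<and>
    (if peaks ?w = 1 \<or> peaks ?w = 2 \<and> separated_parameters (run_lengths ?w)
      then ?w \<in> set (map fst realizations) else obstructed ?w)"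
    using cl unfolding classified_def half if_P[OF dyck] .
  then have cl: "peaks ?w = 1 \<longleftrightarrow> ?w = replicate r True @ replicate r False"
    "if peaks ?w = 1 \<or> peaks ?w = 2 \<and> separated_parameters (run_lengths ?w)
      then ?w \<in> set (map fst realizations) else obstructed ?w"
    using conjunct1 conjunct2 by blast+
  have inter: "interlaced p I J \<longleftrightarrow> peaks ?w = p" for p
    using assms(7) unfolding interlaced_def path by (simp add: card_picks)
  have par: "(\<exists>\<alpha>\<^sub>1 \<beta>\<^sub>1 \<alpha>\<^sub>2 \<beta>\<^sub>2. length_parameters I J = [\<alpha>\<^sub>1, \<beta>\<^sub>1, \<alpha>\<^sub>2, \<beta>\<^sub>2] \<and>
      \<alpha>\<^sub>1 \<noteq> \<beta>\<^sub>1 \<and> \<alpha>\<^sub>1 \<noteq> \<beta>\<^sub>2 \<and> \<alpha>\<^sub>2 \<noteq> \<beta>\<^sub>1 \<and> \<alpha>\<^sub>2 \<noteq> \<beta>\<^sub>2) \<longleftrightarrow> separated_parameters (run_lengths ?w)"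
    unfolding length_parameters_def path run_lengths_map_step separated_parameters_def
    by (auto split: list.splits)
  have "jointly_smallest k {1..n} I J \<longleftrightarrow>
      peaks ?w = 1 \<or> peaks ?w = 2 \<and> separated_parameters (run_lengths ?w)"
    using cl(2) realized_jointly_smallest[OF IJ] not_jointly_smallest[OF IJ] by (auto split: if_splits)
  then show ?thesis
    unfolding arrangement_iff_jointly_smallest[OF IJ] inter par
    using cl(1) weakly_separated_word[OF fin cd(1) dyck] by (simp add: r_def)
qed

end
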